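(* Let $q$ be an odd prime power, let $\mathrm{AG}(3,q)$ be completed to $\mathrm{PG}(3,q)$ by the plane at infinity $\pi_\infty$, and let $\mathcal{C}$ be a non-singular conic in $\pi_\infty$. Let $\mathcal{L}$ be a Kakeya line set in $T^{*}_{2}(\mathcal{C})$ with corresponding Kakeya set $\mathcal{K}(\mathcal{L})$. If $|\mathcal{K}(\mathcal{L})|<\frac34(q^2-1)+q$, then $\mathcal{K}(\mathcal{L})$ is a Kakeya set of the following type: there exist a hyperbolic quadric $\mathcal{Q}$ of $\mathrm{PG}(3,q)$ with $\mathcal{Q}\cap\pi_\infty=\mathcal{C}$, with reguli $\mathcal{R}$ and $\mathcal{R}'$, and a partition of the points of $\mathcal{C}$ into two (possibly empty) sets $A$ and $B$, such that $\mathcal{K}(\mathcal{L})$ is the set of affine points covered by the Kakeya line set consisting of the (affine parts of the) lines of $\mathcal{R}$ through the points of $A$ and the lines of $\mathcal{R}'$ through the points of $B$.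
   Context: The linear representation $T^{*}_{2}(\mathcal{C})$ is the point-line geometry whose points are the points of $\mathrm{AG}(3,q)$, whose lines are the lines of $\mathrm{AG}(3,q)$ whose direction (point at infinity) lies in $\mathcal{C}$, with incidence inherited from $\mathrm{AG}(3,q)$. A Kakeya line set in $T^{*}_{2}(\mathcal{C})$ is a set of lines of $T^{*}_{2}(\mathcal{C})$ containing precisely one line through each point of $\mathcal{C}$; its Kakeya set $\mathcal{K}(\mathcal{L})$ is the set of affine points covered by its lines. A hyperbolic quadric in $\mathrm{PG}(3,q)$ is a quadric projectively equivalent to $X_0X_1+X_2X_3=0$; its $2(q+1)$ lines split into two reguli $\mathcal{R},\mathcal{R}'$ of $q+1$ pairwise disjoint lines each, every line of $\mathcal{R}$ meeting every line of $\mathcal{R}'$. If $\mathcal{Q}\cap\pi_\infty=\mathcal{C}$, each point of $\mathcal{C}$ lies on exactly one line of $\mathcal{R}$ and one line of $\mathcal{R}'$. *)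

theory Defs
  imports "HOL-Analysis.Cartesian_Space"
begin

text \<open>
  The field GF(q) is a type \<open>'a\<close> of sort \<open>{field, finite}\<close>, with \<open>q = CARD('a)\<close>. The points, lines
  and planes of PG(3,q) are the vector subspaces of \<open>'a ^ 4\<close> of dimension 1, 2 and 3, so incidence
  is inclusion.
\<close>

definition pg_points :: "('a::field ^ 4) set set" where
  "pg_points = {P. vec.subspace P \<and> vec.dim P = 1}"

definition pg_lines :: "('a::field ^ 4) set set" where
  "pg_lines = {l. vec.subspace l \<and> vec.dim l = 2}"

definition pg_planes :: "('a::field ^ 4) set set" where
  "pg_planes = {\<pi>. vec.subspace \<pi> \<and> vec.dim \<pi> = 3}"

definition meets :: "('a::field ^ 4) set \<Rightarrow> ('a ^ 4) set \<Rightarrow> bool" where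
  "meets l m \<longleftrightarrow> (\<exists>P\<in>pg_points. P \<subseteq> l \<and> P \<subseteq> m)"

text \<open>
  AG(3,q) is PG(3,q) with a plane \<open>\<pi>\<close>, the plane at infinity, removed. A line of AG(3,q) is
  represented by its projective completion, a line of PG(3,q) not contained in \<open>\<pi>\<close>; its point at
  infinity is then \<open>l \<inter> \<pi>\<close>.
\<close>

definition ag_points :: "('a::field ^ 4) set \<Rightarrow> ('a ^ 4) set set" where
  "ag_points \<pi> = {P \<in> pg_points. \<not> P \<subseteq> \<pi>}"

definition ag_lines :: "('a::field ^ 4) set \<Rightarrow> ('a ^ 4) set set" where
  "ag_lines \<pi> = {l \<in> pg_lines. \<not> l \<subseteq> \<pi>}"

definition quad_form :: "'a::field ^ 4 ^ 4 \<Rightarrow> 'a ^ 4 \<Rightarrow> 'a" where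
  "quad_form M v = (\<Sum>i\<in>UNIV. \<Sum>j\<in>UNIV. M $ i $ j * v $ i * v $ j)"

definition polar_form :: "'a::field ^ 4 ^ 4 \<Rightarrow> 'a ^ 4 \<Rightarrow> 'a ^ 4 \<Rightarrow> 'a" where
  "polar_form M v w = quad_form M (v + w) - quad_form M v - quad_form M w"

text \<open>
  Every quadratic form on \<open>\<pi>\<close> is the restriction of one on the whole space. Non-singularity is
  required of the restriction to \<open>\<pi>\<close> only.
\<close>

definition nonsingular_conic :: "('a::field ^ 4) set \<Rightarrow> ('a ^ 4) set set \<Rightarrow> bool" where
  "nonsingular_conic \<pi> C \<longleftrightarrow>
     (\<exists>M. (\<forall>v\<in>\<pi>. v \<noteq> 0 \<and> quad_form M v = 0 \<longrightarrow> (\<exists>w\<in>\<pi>. polar_form M v w \<noteq> 0)) \<and>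
          C = {P \<in> pg_points. P \<subseteq> \<pi> \<and> (\<forall>v\<in>P. quad_form M v = 0)})"

definition standard_hyperbolic_quadric :: "('a::field ^ 4) set set" where
  "standard_hyperbolic_quadric =
     {P \<in> pg_points. \<forall>v\<in>P. v $ 1 * v $ 2 + v $ 3 * v $ 4 = 0}"

definition hyperbolic_quadric :: "('a::field ^ 4) set set \<Rightarrow> bool" where
  "hyperbolic_quadric Q \<longleftrightarrow>
     (\<exists>T :: 'a ^ 4 ^ 4. invertible T \<and> Q = (\<lambda>P. (*v) T ` P) ` standard_hyperbolic_quadric)"

definition quadric_lines :: "('a::field ^ 4) set set \<Rightarrow> ('a ^ 4) set set" where
  "quadric_lines Q = {l \<in> pg_lines. \<forall>P\<in>pg_points. P \<subseteq> l \<longrightarrow> P \<in> Q}"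

definition reguli :: "('a::{field,finite} ^ 4) set set \<Rightarrow> ('a ^ 4) set set \<Rightarrow> ('a ^ 4) set set \<Rightarrow> bool" where
  "reguli Q R R' \<longleftrightarrow>
     R \<union> R' = quadric_lines Q \<and> R \<inter> R' = {} \<and>
     card R = CARD('a) + 1 \<and> card R' = CARD('a) + 1 \<and>
     (\<forall>l\<in>R. \<forall>m\<in>R. l \<noteq> m \<longrightarrow> \<not> meets l m) \<and>
     (\<forall>l\<in>R'. \<forall>m\<in>R'. l \<noteq> m \<longrightarrow> \<not> meets l m) \<and>
     (\<forall>l\<in>R. \<forall>m\<in>R'. meets l m)"

text \<open>The points of the linear representation are \<open>ag_points \<pi>\<close>; these are its lines.\<close>

definition linear_rep_lines :: "('a::field ^ 4) set \<Rightarrow> ('a ^ 4) set set \<Rightarrow> ('a ^ 4) set set" where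
  "linear_rep_lines \<pi> C = {l \<in> ag_lines \<pi>. l \<inter> \<pi> \<in> C}"

definition kakeya_line_set ::
    "('a::field ^ 4) set \<Rightarrow> ('a ^ 4) set set \<Rightarrow> ('a ^ 4) set set \<Rightarrow> bool" where
  "kakeya_line_set \<pi> C L \<longleftrightarrow> L \<subseteq> linear_rep_lines \<pi> C \<and> (\<forall>P\<in>C. \<exists>!l. l \<in> L \<and> P \<subseteq> l)"

definition kakeya_set :: "('a::field ^ 4) set \<Rightarrow> ('a ^ 4) set set \<Rightarrow> ('a ^ 4) set set" where
  "kakeya_set \<pi> L = {X \<in> ag_points \<pi>. \<exists>l\<in>L. X \<subseteq> l}"

definition lines_through :: "('a::field ^ 4) set set \<Rightarrow> ('a ^ 4) set set \<Rightarrow> ('a ^ 4) set set" where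
  "lines_through R A = {l \<in> R. \<exists>P\<in>A. P \<subseteq> l}"

end

theory Submission imports Defs
begin

text \<open>
  Let \<open>V\<close> be the \<open>q + 1\<close> lines of the Kakeya line set and call \<open>q |W| - |K(W)|\<close> the excess of \<open>W \<subseteq> V\<close>.
  No three points of the conic are collinear, so three pairwise meeting lines of \<open>V\<close> are concurrent,
  and Mantel's argument bounds the excess of \<open>W\<close> by \<open>|W|\<^sup>2 / 4\<close>. The hypothesis says that the
  excess of \<open>V\<close> exceeds \<open>(q\<^sup>2 + 3) / 4\<close>. This forces some line \<open>t\<close> to meet two others, \<open>u\<close> and \<open>w\<close>, in
  different points, and there is a hyperbolic quadric through \<open>u\<close>, \<open>t\<close>, \<open>w\<close> and the conic.
  Let \<open>S\<close> be the set of the \<open>s \<ge> 3\<close> lines of \<open>V\<close> on this quadric. The other \<open>k = q + 1 - s\<close> lines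
  meet the quadric at infinity, hence in at most one affine point, and the excess of \<open>V\<close> is at most
  \<open>s\<^sup>2 / 4 + k\<^sup>2 / 4 + k\<close>. If \<open>k \<ge> 1\<close>, this is at most \<open>(q\<^sup>2 + 5) / 4\<close>; the excess is an integer and
  \<open>q\<close> is odd, so it is at most \<open>(q\<^sup>2 + 3) / 4\<close>, a contradiction. Hence all lines lie on the quadric.
\<close>

section \<open>Lines covering few points\<close>

text \<open>The counting uses only this incidence data. Later \<open>blk l\<close> is the set of
  affine points of \<open>l\<close>, and \<open>triangle\<close> (pairwise meeting lines are
  concurrent) expresses that no three points of the conic are collinear.\<close>

locale line_family =
  fixes L :: "'l set" and blk :: "'l \<Rightarrow> 'p set" and q :: nat
  assumes finite_L: "finite L"
    and q_pos: "0 < q"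
    and card_blk: "l \<in> L \<Longrightarrow> card (blk l) = q"
    and meet_unique: "\<lbrakk>l \<in> L; m \<in> L; l \<noteq> m; x \<in> blk l; x \<in> blk m; y \<in> blk l; y \<in> blk m\<rbrakk> \<Longrightarrow> x = y"
    and triangle: "\<lbrakk>l \<in> L; m \<in> L; n \<in> L; l \<noteq> m; m \<noteq> n; l \<noteq> n; x \<in> blk l; x \<in> blk m;
      y \<in> blk m; y \<in> blk n; z \<in> blk l; z \<in> blk n\<rbrakk> \<Longrightarrow> x = y"
begin

lemma finite_blk: "l \<in> L \<Longrightarrow> finite (blk l)"
  using card_blk q_pos card_ge_0_finite by metis

lemma card_UN_inter_le:
  assumes "finite W" "\<And>n. n \<in> W \<Longrightarrow> finite (blk n \<inter> Z) \<and> card (blk n \<inter> Z) \<le> 1"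
  shows "card ((\<Union>n\<in>W. blk n) \<inter> Z) \<le> card W"
proof -
  have "(\<Union>n\<in>W. blk n) \<inter> Z = (\<Union>n\<in>W. blk n \<inter> Z)" by auto
  also have "card \<dots> \<le> (\<Sum>n\<in>W. card (blk n \<inter> Z))"
    using assms(1) by (rule card_UN_le)
  also have "\<dots> \<le> (\<Sum>n\<in>W. 1)" using assms(2) by (intro sum_mono) auto
  finally show ?thesis by simp
qed

lemma card_le_1:
  assumes "\<And>a b. a \<in> A \<Longrightarrow> b \<in> A \<Longrightarrow> a = b"
  shows "finite A \<and> card A \<le> 1"
proof (cases "A = {}")
  case False
  then obtain a where "A = {a}" using assms by blast
  then show ?thesis by simp
qed simp

text \<open>Induction, removing two meeting lines \<open>l\<close> and \<open>m\<close>. Every other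
  line has at most one point on their union, so removing them lowers the excess by at most
  \<open>1 + (|W| - 2)\<close>, which equals \<open>(|W|\<^sup>2 - (|W| - 2)\<^sup>2) / 4\<close>.
  Pairwise disjoint lines have excess 0.\<close>

lemma mantel:
  assumes "W \<subseteq> L"
  shows "4 * q * card W \<le> 4 * card (\<Union>l\<in>W. blk l) + (card W)\<^sup>2"
  using assms
proof (induction "card W" arbitrary: W rule: less_induct)
  case less
  have finW: "finite W" using less.prems finite_L finite_subset by blast
  have fin: "finite (\<Union>l\<in>U. blk l)" if "U \<subseteq> W" for U
    using that finW less.prems finite_blk by (meson finite_UN_I finite_subset subsetD)
  show ?case
  proof (cases "\<exists>l\<in>W. \<exists>m\<in>W. l \<noteq> m \<and> blk l \<inter> blk m \<noteq> {}")
    case False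
    have "card (\<Union>l\<in>W. blk l) = (\<Sum>l\<in>W. card (blk l))"
      using finW False less.prems finite_blk by (intro card_UN_disjoint) auto
    also have "\<dots> = card W * q" using less.prems card_blk by (simp add: subset_iff)
    finally show ?thesis by simp
  next
    case True
    then obtain l m x where lm: "l \<in> W" "m \<in> W" "l \<noteq> m" and x: "x \<in> blk l" "x \<in> blk m"
      by blast
    define W' where "W' = W - {l, m}"
    have W': "W' \<subseteq> L" "finite W'" using less.prems finW by (auto simp: W'_def)
    have cW: "card W = card W' + 2"
    proof -
      have "W = insert l (insert m W')" "l \<notin> insert m W'" "m \<notin> W'"
        using lm by (auto simp: W'_def)
      then show ?thesis using W'(2) by simp
    qed
    have IH: "4 * q * card W' \<le> 4 * card (\<Union>l\<in>W'. blk l) + (card W')\<^sup>2"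
      using less.hyps W' cW by simp
    have one: "finite (blk n \<inter> (blk l \<union> blk m)) \<and> card (blk n \<inter> (blk l \<union> blk m)) \<le> 1"
      if "n \<in> W'" for n
    proof (rule card_le_1)
      have n: "n \<in> L" "n \<noteq> l" "n \<noteq> m" using that W' by (auto simp: W'_def)
      have lmL: "l \<in> L" "m \<in> L" using lm less.prems by auto
      \<comment> \<open>If \<open>n\<close> meets \<open>l\<close> in \<open>a\<close> and
        \<open>m\<close> in \<open>b\<close>, then \<open>triangle\<close> in both orders gives
        \<open>x = b\<close> and \<open>x = a\<close>.\<close>
      have mixed: "a = b" if "a \<in> blk n" "a \<in> blk l" "b \<in> blk n" "b \<in> blk m" for a b
        using triangle[of l m n x b a] triangle[of m l n x a b] n lmL lm x that by simp
      fix a b assume "a \<in> blk n \<inter> (blk l \<union> blk m)" "b \<in> blk n \<inter> (blk l \<union> blk m)"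
      then show "a = b" using mixed meet_unique n lmL by blast
    qed
    have "card ((\<Union>n\<in>W'. blk n) \<inter> (blk l \<union> blk m)) \<le> card W'"
      using W'(2) one by (rule card_UN_inter_le)
    moreover have "card (blk l \<union> blk m) + 1 = 2 * q"
    proof -
      have "blk l \<inter> blk m = {x}"
        using meet_unique[of l m] lm x less.prems by blast
      then show ?thesis
        using card_Un_Int[of "blk l" "blk m"] card_blk finite_blk lm less.prems by (simp add: subset_iff)
    qed
    moreover have "card (\<Union>n\<in>W'. blk n) + card (blk l \<union> blk m)
        = card (\<Union>n\<in>W. blk n) + card ((\<Union>n\<in>W'. blk n) \<inter> (blk l \<union> blk m))"
    proof -
      have "(\<Union>n\<in>W. blk n) = (\<Union>n\<in>W'. blk n) \<union> (blk l \<union> blk m)"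
        using lm by (auto simp: W'_def)
      moreover have "finite (\<Union>n\<in>W'. blk n)" "finite (blk l \<union> blk m)"
        using fin[of W'] fin[of "{l,m}"] lm by (auto simp: W'_def)
      ultimately show ?thesis using card_Un_Int by metis
    qed
    ultimately have "card (\<Union>n\<in>W'. blk n) + 2 * q \<le> card (\<Union>n\<in>W. blk n) + card W' + 1"
      by linarith
    then show ?thesis
      using IH by (simp add: cW power2_eq_square algebra_simps)
  qed
qed

text \<open>Without such a path every line shares at most one of its points with the other lines, so
  it has at least \<open>q - 1\<close> private points, and \<open>q + 1\<close> such lines cover too
  much.\<close>

lemma exists_path:
  assumes cL: "card L = q + 1"
    and small: "card (\<Union>l\<in>L. blk l) < q\<^sup>2"
  obtains u t w x y where "u \<in> L" "t \<in> L" "w \<in> L" "u \<noteq> t" "t \<noteq> w" "u \<noteq> w"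
    "x \<in> blk u" "x \<in> blk t" "y \<in> blk t" "y \<in> blk w" "x \<noteq> y"
proof (rule ccontr)
  note that' = that
  assume contr: "\<not> thesis"
  have one: "x = y" if "t \<in> L" "u \<in> L" "w \<in> L" "u \<noteq> t" "w \<noteq> t" "x \<in> blk t" "x \<in> blk u"
    "y \<in> blk t" "y \<in> blk w" for t u w x y
  proof (cases "u = w")
    case True then show ?thesis using meet_unique[of t u x y] that by auto
  next
    case False then show ?thesis using that'[of u t w x y] contr that by auto
  qed
  obtain l where l: "l \<in> L" using cL by fastforce
  define priv where "priv m = blk m - (\<Union>n\<in>L-{m}. blk n)" for m
  have priv: "q - 1 \<le> card (priv m)" if "m \<in> L" for m
  proof -
    have "finite (blk m \<inter> (\<Union>n\<in>L-{m}. blk n)) \<and> card (blk m \<inter> (\<Union>n\<in>L-{m}. blk n)) \<le> 1"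
      by (rule card_le_1) (use one[of m] that in blast)
    then show ?thesis
      unfolding priv_def using card_Diff_subset_Int card_blk that by (metis diff_le_mono2)
  qed
  \<comment> \<open>One line counts with all its \<open>q\<close> points, the other \<open>q\<close>
    lines only with their private points; in total \<open>q + q (q - 1) = q\<^sup>2\<close>.\<close>
  have "q + (\<Sum>m\<in>L-{l}. q - 1) \<le> card (blk l) + (\<Sum>m\<in>L-{l}. card (priv m))"
    using priv l card_blk by (intro add_mono sum_mono) auto
  also have "(\<Sum>m\<in>L-{l}. card (priv m)) = card (\<Union>m\<in>L-{l}. priv m)"
    by (rule card_UN_disjoint[symmetric]) (use finite_L finite_blk in \<open>auto simp: priv_def\<close>)
  also have "card (blk l) + \<dots> = card (blk l \<union> (\<Union>m\<in>L-{l}. priv m))"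
    by (rule card_Un_disjoint[symmetric]) (use finite_L finite_blk l in \<open>auto simp: priv_def\<close>)
  also have "\<dots> \<le> card (\<Union>l\<in>L. blk l)"
    by (rule card_mono) (use finite_L finite_blk l in \<open>auto simp: priv_def\<close>)
  finally have "q + q * (q - 1) \<le> card (\<Union>l\<in>L. blk l)"
    using l cL by simp
  moreover have "q + q * (q - 1) = q\<^sup>2" using q_pos by (cases q) (auto simp: power2_eq_square)
  ultimately show False using small by simp
qed

text \<open>The family \<open>\<Z>\<close> stands for the hyperbolic quadrics through the conic,
  seen as sets of points. It enters only through two facts: each path lies in a member, and a line
  not inside a member has at most one of its points there.\<close>

theorem covered:
  assumes odd: "odd q" and cL: "card L = q + 1"
    and small: "4 * card (\<Union>l\<in>L. blk l) < 3 * (q\<^sup>2 - 1) + 4 * q"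
    and quadric: "\<And>u t w x y. \<lbrakk>u \<in> L; t \<in> L; w \<in> L; u \<noteq> t; t \<noteq> w; u \<noteq> w;
      x \<in> blk u; x \<in> blk t; y \<in> blk t; y \<in> blk w; x \<noteq> y\<rbrakk>
      \<Longrightarrow> \<exists>Z\<in>\<Z>. blk u \<subseteq> Z \<and> blk t \<subseteq> Z \<and> blk w \<subseteq> Z"
    and secant: "\<And>Z l x y. \<lbrakk>Z \<in> \<Z>; l \<in> L; \<not> blk l \<subseteq> Z; x \<in> blk l \<inter> Z; y \<in> blk l \<inter> Z\<rbrakk> \<Longrightarrow> x = y"
  obtains Z where "Z \<in> \<Z>" "\<And>l. l \<in> L \<Longrightarrow> blk l \<subseteq> Z"
proof -
  \<comment> \<open>This is \<open>3 (q\<^sup>2 - 1) + 4 q \<le> 4 q\<^sup>2\<close> rearranged,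
    which turns the hypothesis into the bound \<open>q\<^sup>2\<close> of
    \<open>exists_path\<close>. It fails for \<open>q = 2\<close>, which parity excludes.\<close>
  have q1: "(int q - 1) * (int q - 3) \<ge> 0"
  proof (cases "q = 1")
    case False
    then have "q \<ge> 3" using odd q_pos by (cases "q = 2") auto
    then show ?thesis by simp
  qed simp
  have q2: "int (3 * (q\<^sup>2 - 1) + 4 * q) = 3 * ((int q)\<^sup>2 - 1) + 4 * int q"
    using q_pos by (simp add: of_nat_diff)
  have "card (\<Union>l\<in>L. blk l) < q\<^sup>2"
  proof -
    have "4 * int (card (\<Union>l\<in>L. blk l)) < 3 * ((int q)\<^sup>2 - 1) + 4 * int q"
      using small q2 by linarith
    also have "\<dots> \<le> 4 * (int q)\<^sup>2" using q1 by (simp add: power2_eq_square algebra_simps)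
    finally show ?thesis by (metis of_nat_less_iff of_nat_power mult_less_cancel_left_pos zero_less_numeral)
  qed
  from exists_path[OF cL this] obtain u t w x y where
    path: "u \<in> L" "t \<in> L" "w \<in> L" "u \<noteq> t" "t \<noteq> w" "u \<noteq> w"
    "x \<in> blk u" "x \<in> blk t" "y \<in> blk t" "y \<in> blk w" "x \<noteq> y" .
  from quadric[OF path] obtain Z where Z: "Z \<in> \<Z>" "blk u \<subseteq> Z" "blk t \<subseteq> Z" "blk w \<subseteq> Z"
    by blast
  define S where "S = {l \<in> L. blk l \<subseteq> Z}"
  define T where "T = L - S"
  have T: "T = {}"
  proof (rule ccontr)
    assume "T \<noteq> {}"
    have ST: "S \<subseteq> L" "T \<subseteq> L" "finite S" "finite T" using finite_L by (auto simp: S_def T_def)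
    define s k where "s = card S" and "k = card T"
    have k1: "1 \<le> k" using \<open>T \<noteq> {}\<close> ST by (simp add: k_def Suc_le_eq card_gt_0_iff)
    have "{u,t,w} \<subseteq> S" using path Z by (auto simp: S_def)
    then have s3: "3 \<le> s" using card_mono[OF ST(3), of "{u,t,w}"] path by (simp add: s_def)
    have sk: "s + k = q + 1"
      using cL card_Un_disjoint[of S T] ST by (simp add: s_def k_def T_def Un_absorb1)
    let ?K = "\<lambda>W. \<Union>l\<in>W. blk l"
    have fin: "finite (?K S)" "finite (?K T)" using ST finite_blk by blast+
    have int1: "finite (blk n \<inter> Z) \<and> card (blk n \<inter> Z) \<le> 1" if "n \<in> T" for n
      by (rule card_le_1) (use secant[OF Z(1)] that in \<open>auto simp: T_def S_def\<close>)
    \<comment> \<open>Points shared by the two groups lie in \<open>Z\<close>, where each of the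
      \<open>k\<close> lines of \<open>T\<close> has at most one point.\<close>
    have "card (?K S \<inter> ?K T) \<le> card (?K T \<inter> Z)"
      by (rule card_mono) (use fin in \<open>auto simp: S_def\<close>)
    also have "\<dots> \<le> k" unfolding k_def using ST(4) int1 by (rule card_UN_inter_le)
    finally have "card (?K S) + card (?K T) \<le> card (?K L) + k"
      using card_Un_Int[OF fin] ST by (simp add: T_def UN_Un[symmetric] Un_absorb1)
    moreover have "4 * q * s \<le> 4 * card (?K S) + s\<^sup>2" "4 * q * k \<le> 4 * card (?K T) + k\<^sup>2"
      unfolding s_def k_def using mantel ST by auto
    ultimately have "4 * q * s + 4 * q * k \<le> 4 * card (?K L) + 4 * k + s\<^sup>2 + k\<^sup>2" by linarith
    then have "4 * q * (s + k) \<le> 4 * card (?K L) + 4 * k + s\<^sup>2 + k\<^sup>2" by (simp add: algebra_simps)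
    then have main: "4 * int q * (int q + 1) \<le> 4 * int (card (?K L)) + 4 * int k + (int s)\<^sup>2 + (int k)\<^sup>2"
      unfolding sk by (metis (mono_tags, lifting) of_nat_le_iff of_nat_add of_nat_mult of_nat_numeral of_nat_power of_nat_1)
    \<comment> \<open>With \<open>s + k = q + 1\<close> this product bounds \<open>s k\<close> from
      below, and \<open>s\<^sup>2 + k\<^sup>2 + 4 k = (q + 1)\<^sup>2 - 2 s k + 4 k\<close> becomes
      at most \<open>q\<^sup>2 + 5\<close>.\<close>
    have "(int s - 3) * (int k - 1) \<ge> 0" using s3 k1 by simp
    moreover have s: "int s = int q + 1 - int k" using sk by linarith
    ultimately have "4 * int k + (int s)\<^sup>2 + (int k)\<^sup>2 \<le> (int q)\<^sup>2 + 5"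
      unfolding s by (simp add: power2_eq_square algebra_simps)
    with main have *: "4 * int q * (int q + 1) \<le> 4 * int (card (?K L)) + (int q)\<^sup>2 + 5" by linarith
    obtain j where j: "int q = 2 * j + 1" using odd by (metis oddE of_nat_add of_nat_mult of_nat_1 of_nat_numeral)
    have "4 * int (card (?K L)) < 3 * ((int q)\<^sup>2 - 1) + 4 * int q"
      using small q2 by linarith
    \<comment> \<open>With \<open>q = 2 j + 1\<close> both bounds on the number of covered points
      have the common part \<open>4 (5 j + 3 j\<^sup>2)\<close>; what is left confines
      \<open>4 d\<close> to the interval from 2 to 3, which contains no multiple of 4.\<close>
    moreover define d where "d = int (card (?K L)) - 5 * j - 3 * j\<^sup>2"
    ultimately have "2 \<le> 4 * d" "4 * d < 4"
      using * unfolding j by (simp_all add: power2_eq_square algebra_simps)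
    then show False by presburger
  qed
  show thesis
    by (rule that[OF Z(1)]) (use T in \<open>auto simp: T_def S_def\<close>)
qed

end

section \<open>Subspaces of small dimension\<close>

text \<open>Stated by coefficients for a pair rather than for the set \<open>{x, y}\<close>, so that
  equal vectors count as dependent.\<close>

definition indep2 :: "'a::field ^ 'n \<Rightarrow> 'a ^ 'n \<Rightarrow> bool" where
  "indep2 x y \<longleftrightarrow> (\<forall>a b. a *s x + b *s y = 0 \<longrightarrow> a = 0 \<and> b = 0)"

definition indep3 :: "'a::field ^ 'n \<Rightarrow> 'a ^ 'n \<Rightarrow> 'a ^ 'n \<Rightarrow> bool" where
  "indep3 x y z \<longleftrightarrow> (\<forall>a b c. a *s x + b *s y + c *s z = 0 \<longrightarrow> a = 0 \<and> b = 0 \<and> c = 0)"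

lemma in_span1: "v \<in> vec.span {x} \<longleftrightarrow> (\<exists>a. v = a *s x)"
  by (auto simp: vec.span_singleton)

lemma in_span2: "v \<in> vec.span {x, y} \<longleftrightarrow> (\<exists>a b. v = a *s x + b *s y)"
proof -
  have "v \<in> vec.span {x, y} \<longleftrightarrow> (\<exists>a b. v - a *s x = b *s y)"
    by (simp add: vec.span_breakdown_eq in_span1)
  also have "\<dots> \<longleftrightarrow> (\<exists>a b. v = a *s x + b *s y)" by (simp add: algebra_simps)
  finally show ?thesis .
qed

lemma in_span3: "v \<in> vec.span {x, y, z} \<longleftrightarrow> (\<exists>a b c. v = a *s x + b *s y + c *s z)"
proof -
  have "v \<in> vec.span {x, y, z} \<longleftrightarrow> (\<exists>a b c. v - a *s x = b *s y + c *s z)"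
    by (simp add: vec.span_breakdown_eq[of v x] in_span2)
  also have "\<dots> \<longleftrightarrow> (\<exists>a b c. v = a *s x + b *s y + c *s z)" by (simp add: algebra_simps)
  finally show ?thesis .
qed

lemma indep2_iff: "indep2 x y \<longleftrightarrow> y \<noteq> 0 \<and> x \<notin> vec.span {y}"
proof
  assume i: "indep2 x y"
  have "y \<noteq> 0" using i[unfolded indep2_def, rule_format, of 0 1] by auto
  moreover have "x \<noteq> a *s y" for a
    using i[unfolded indep2_def, rule_format, of 1 "-a"] by auto
  ultimately show "y \<noteq> 0 \<and> x \<notin> vec.span {y}" by (simp add: in_span1)
next
  assume r: "y \<noteq> 0 \<and> x \<notin> vec.span {y}"
  show "indep2 x y" unfolding indep2_def
  proof (intro allI impI)
    fix a b assume e: "a *s x + b *s y = 0"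
    have "a = 0"
    proof (rule ccontr)
      assume a: "a \<noteq> 0"
      have "a *s x = (- b) *s y" using e by (simp add: eq_neg_iff_add_eq_0)
      then have "inverse a *s (a *s x) = inverse a *s ((- b) *s y)" by simp
      then have "x = (inverse a * - b) *s y" using a by (simp only: vec.scale_scale) simp
      then show False using r unfolding in_span1 by blast
    qed
    with e r show "a = 0 \<and> b = 0" by (simp add: vector_mul_eq_0)
  qed
qed

lemma indep2_commute: "indep2 x y \<longleftrightarrow> indep2 y x"
  unfolding indep2_def by (metis add.commute)

lemma dim_span2: "indep2 x y \<Longrightarrow> vec.dim (vec.span {x, y}) = 2"
  unfolding indep2_iff by (simp add: vec.dim_insert)

lemma pg_linesI: "indep2 x y \<Longrightarrow> vec.span {x, y} \<in> pg_lines"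
  unfolding pg_lines_def using dim_span2 by (simp add: vec.subspace_span)

lemma pg_line_eq_span:
  assumes "l \<in> pg_lines" "x \<in> l" "y \<in> l" "indep2 x y"
  shows "l = vec.span {x, y}"
proof -
  have "vec.span {x, y} = l"
    using assms dim_span2[of x y] 
    by (intro vec.subspace_dim_equal vec.span_minimal) (auto simp: pg_lines_def vec.subspace_span)
  then show ?thesis by simp
qed

lemma pg_points_iff: "P \<in> pg_points \<longleftrightarrow> (\<exists>v. v \<noteq> 0 \<and> P = vec.span {v})"
proof
  assume P: "P \<in> pg_points"
  then have "vec.subspace P" "vec.dim P = 1" by (auto simp: pg_points_def)
  then have "\<not> P \<subseteq> {0}" using vec.dim_eq_0[of P] by simp
  then obtain v where v: "v \<in> P" "v \<noteq> 0" by auto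
  then have "vec.span {v} = P"
    using P by (intro vec.subspace_dim_equal vec.span_minimal) (auto simp: pg_points_def vec.subspace_span)
  with v show "\<exists>v. v \<noteq> 0 \<and> P = vec.span {v}" by blast
qed (auto simp: pg_points_def vec.subspace_span)

lemma pg_point_eq_span:
  assumes "P \<in> pg_points" "v \<in> P" "v \<noteq> 0"
  shows "P = vec.span {v}"
proof -
  have "vec.span {v} = P"
    using assms by (intro vec.subspace_dim_equal vec.span_minimal) (auto simp: pg_points_def vec.subspace_span)
  then show ?thesis by simp
qed

lemma span1_eq_iff:
  fixes v :: "'a::field ^ 'n"
  assumes "v \<noteq> 0"
  shows "vec.span {v} = vec.span {w} \<longleftrightarrow> (\<exists>c. c \<noteq> 0 \<and> w = c *s v)"
proof
  assume e: "vec.span {v} = vec.span {w}"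
  then have "w \<in> vec.span {v}" using vec.span_base[of w "{w}"] by simp
  then obtain c where "w = c *s v" using in_span1 by blast
  moreover have "w \<noteq> 0" using e assms vec.span_base[of v "{v}"] by auto
  ultimately show "\<exists>c. c \<noteq> 0 \<and> w = c *s v" by auto
next
  assume "\<exists>c. c \<noteq> 0 \<and> w = c *s v"
  then obtain c where c: "c \<noteq> 0" "w = c *s v" by blast
  have "v \<in> vec.span {w}" unfolding in_span1 c
    by (rule exI[of _ "inverse c"]) (use c in simp)
  moreover have "w \<in> vec.span {v}" using c in_span1 by blast
  ultimately show "vec.span {v} = vec.span {w}"
    by (intro equalityI vec.span_minimal) (auto simp: vec.subspace_span)
qed

lemma span1_subset_iff: "vec.subspace S \<Longrightarrow> vec.span {v} \<subseteq> S \<longleftrightarrow> v \<in> S"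
  using vec.span_base[of v "{v}"] vec.span_minimal[of "{v}" S] by auto

lemma distinct_points_indep2:
  assumes "P \<in> pg_points" "P' \<in> pg_points" "P \<noteq> P'" "x \<in> P" "y \<in> P'" "x \<noteq> 0" "y \<noteq> 0"
  shows "indep2 x y"
proof -
  have P: "P = vec.span {x}" "P' = vec.span {y}" using assms pg_point_eq_span by auto
  have "x \<notin> vec.span {y}" using pg_point_eq_span[OF assms(2), of x] assms P by auto
  then show ?thesis using assms by (simp add: indep2_iff)
qed

text \<open>By dimension. The vectors \<open>x\<close> and \<open>y\<close> may coincide or vanish,
  so the lemma serves to choose each vector of a basis of the plane in turn.\<close>

lemma plane_diff_span2:
  assumes "\<pi> \<in> pg_planes"
  obtains v where "v \<in> \<pi>" "v \<notin> vec.span {x, y}"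
proof -
  have "vec.dim (vec.span {x, y}) \<le> 2"
    by (simp add: vec.dim_insert)
  then have "\<not> \<pi> \<subseteq> vec.span {x, y}"
    using vec.dim_subset[of \<pi> "vec.span {x, y}"] assms by (auto simp: pg_planes_def)
  with that show thesis by blast
qed

lemma plane_eq_span3:
  assumes "\<pi> \<in> pg_planes" "x \<in> \<pi>" "y \<in> \<pi>" "z \<in> \<pi>" "indep2 x y" "z \<notin> vec.span {x, y}"
  shows "\<pi> = vec.span {x, y, z}"
proof -
  have "vec.dim (insert z {x, y}) = 3"
    using dim_span2[OF assms(5)] assms(6) by (subst vec.dim_insert) simp
  then have "vec.span {z, x, y} = \<pi>"
    using assms by (intro vec.subspace_dim_equal vec.span_minimal) (auto simp: pg_planes_def vec.subspace_span)
  then show ?thesis by (simp add: insert_commute)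
qed

lemma indep3I: "indep2 x y \<Longrightarrow> z \<notin> vec.span {x, y} \<Longrightarrow> indep3 x y z"
  unfolding indep3_def
proof (intro allI impI)
  fix a b c assume i: "indep2 x y" "z \<notin> vec.span {x, y}" and e: "a *s x + b *s y + c *s z = 0"
  have c: "c = 0"
  proof (rule ccontr)
    assume c: "c \<noteq> 0"
    have "c *s z = (-a) *s x + (-b) *s y" using e
      by (simp add: eq_neg_iff_add_eq_0 algebra_simps)
    then have "inverse c *s (c *s z) = (inverse c * -a) *s x + (inverse c * -b) *s y"
      by (simp only: vec.scale_right_distrib vec.scale_scale)
    then have "z = (inverse c * -a) *s x + (inverse c * -b) *s y" using c by simp
    then show False using i unfolding in_span2 by blast
  qed
  with e i(1) show "a = 0 \<and> b = 0 \<and> c = 0" unfolding indep2_def by simp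
qed

text \<open>A plane and a vector off it span the space. This later rescales a representative of an
  affine point so that its difference from another one lies at infinity.\<close>

lemma plane_split:
  assumes "\<pi> \<in> pg_planes" "p \<notin> \<pi>"
  obtains k where "v - k *s p \<in> \<pi>"
proof -
  have pi: "vec.subspace \<pi>" "vec.dim \<pi> = 3" using assms by (auto simp: pg_planes_def)
  have sp: "vec.span \<pi> = \<pi>" using pi vec.span_eq_iff by blast
  have "vec.dim (insert p \<pi>) = 4" unfolding vec.dim_insert sp using assms pi by simp
  then have "vec.span (insert p \<pi>) = UNIV"
    using vec.dim_eq_full[of "insert p \<pi>"] by (simp add: vec.dimension_def card_cart_basis)
  then have "v \<in> vec.span (insert p \<pi>)" by simp
  then show thesis using that by (auto simp: vec.span_breakdown_eq sp)
qed

lemma scale_mem_subspace_iff: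
  "vec.subspace S \<Longrightarrow> c *s v \<in> S \<longleftrightarrow> c = 0 \<or> v \<in> S"
  using vec.subspace_scale[of S v c] vec.subspace_scale[of S "c *s v" "inverse c"] vec.subspace_0[of S]
  by (cases "c = 0") auto

section \<open>The affine points of a line\<close>

definition affine_part :: "('a::field ^ 4) set \<Rightarrow> ('a ^ 4) set \<Rightarrow> ('a ^ 4) set set" where
  "affine_part \<pi> l = {X \<in> ag_points \<pi>. X \<subseteq> l}"

lemma affine_partE:
  assumes "vec.subspace \<pi>" "X \<in> affine_part \<pi> l"
  obtains x where "x \<noteq> 0" "X = vec.span {x}" "x \<in> l" "x \<notin> \<pi>"
proof -
  from assms(2) obtain x where x: "x \<noteq> 0" "X = vec.span {x}" "\<not> X \<subseteq> \<pi>" "X \<subseteq> l"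
    by (auto simp: affine_part_def ag_points_def pg_points_iff)
  then show thesis using that[of x] span1_subset_iff[OF assms(1), of x] vec.span_base[of x "{x}"] by auto
qed

lemma ag_line_eq_span:
  assumes "\<pi> \<in> pg_planes" "l \<in> ag_lines \<pi>" "d \<in> l" "d \<in> \<pi>" "d \<noteq> 0" "p \<in> l" "p \<notin> \<pi>"
  shows "indep2 d p" "l = vec.span {d, p}"
proof -
  have "vec.subspace \<pi>" using assms by (auto simp: pg_planes_def)
  then have "p \<notin> vec.span {d}" using assms by (auto simp: in_span1 vec.subspace_scale)
  then show "indep2 d p" using assms indep2_iff indep2_commute by metis
  then show "l = vec.span {d, p}" using assms by (intro pg_line_eq_span) (auto simp: ag_lines_def)
qed

text \<open>A vector of the line off the plane has a nonzero coefficient at \<open>p\<close>;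
  dividing by it normalises the representative to \<open>p + s *s d\<close>. Together with
  injectivity in \<open>s\<close> this counts the affine points.\<close>

lemma affine_part_eq:
  assumes "\<pi> \<in> pg_planes" "d \<in> \<pi>" "p \<notin> \<pi>"
  shows "affine_part \<pi> (vec.span {d, p}) = range (\<lambda>s. vec.span {p + s *s d})"
proof -
  have S: "vec.subspace \<pi>" using assms by (auto simp: pg_planes_def)
  have np: "p + s *s d \<notin> \<pi>" for s
    using vec.subspace_diff[OF S, of "p + s *s d" "s *s d"] vec.subspace_scale[OF S] assms by auto
  have n0: "p + s *s d \<noteq> 0" for s using np vec.subspace_0[OF S] by metis
  show ?thesis
  proof (intro equalityI subsetI)
    fix X assume "X \<in> affine_part \<pi> (vec.span {d, p})"
    then obtain x where x: "X = vec.span {x}" "x \<in> vec.span {d, p}" "x \<notin> \<pi>" "x \<noteq> 0"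
      using affine_partE[OF S] by blast
    then obtain a b where ab: "x = a *s d + b *s p" by (auto simp: in_span2)
    have "b \<noteq> 0" using ab x vec.subspace_scale[OF S, of d a] assms by auto
    then have "x = b *s (p + (a / b) *s d)" by (simp add: ab vec.scale_right_distrib)
    then have "X = vec.span {p + (a / b) *s d}"
      using span1_eq_iff[OF n0] \<open>b \<noteq> 0\<close> x by metis
    then show "X \<in> range (\<lambda>s. vec.span {p + s *s d})" by blast
  next
    fix X assume "X \<in> range (\<lambda>s. vec.span {p + s *s d})"
    then obtain s where X: "X = vec.span {p + s *s d}" by blast
    have "p + s *s d \<in> vec.span {d, p}"
      unfolding in_span2 by (rule exI[of _ s], rule exI[of _ 1]) simp
    then show "X \<in> affine_part \<pi> (vec.span {d, p})"
      unfolding affine_part_def ag_points_def X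
      using n0 np span1_subset_iff[OF S] span1_subset_iff[OF vec.subspace_span]
      by (simp add: pg_points_iff) blast
  qed
qed

lemma inj_affine_points:
  assumes "\<pi> \<in> pg_planes" "d \<in> \<pi>" "d \<noteq> 0" "p \<notin> \<pi>"
  shows "inj (\<lambda>s. vec.span {p + s *s d})"
proof (rule injI)
  fix s t assume e: "vec.span {p + s *s d} = vec.span {p + t *s d}"
  have S: "vec.subspace \<pi>" using assms by (auto simp: pg_planes_def)
  have "p + s *s d \<noteq> 0"
    using vec.subspace_neg[OF S, of "s *s d"] vec.subspace_scale[OF S] assms
    by (metis eq_neg_iff_add_eq_0)
  with e obtain c where c: "p + t *s d = c *s (p + s *s d)" using span1_eq_iff by blast
  \<comment> \<open>The right side lies in the plane and \<open>p\<close> does not, so the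
    coefficient of \<open>p\<close> must vanish.\<close>
  then have 1: "(1 - c) *s p = (c * s - t) *s d" by (simp add: vec.scale_right_distrib algebra_simps)
  then have "(1 - c) *s p \<in> \<pi>" using vec.subspace_scale[OF S] assms by simp
  then have "c = 1" using scale_mem_subspace_iff[OF S] assms by auto
  with 1 show "s = t" using assms by (simp add: vector_mul_eq_0)
qed

lemma card_affine_part:
  fixes \<pi> :: "('a::{field,finite} ^ 4) set"
  assumes "\<pi> \<in> pg_planes" "d \<in> \<pi>" "d \<noteq> 0" "p \<notin> \<pi>"
  shows "card (affine_part \<pi> (vec.span {d, p})) = CARD('a)"
  using affine_part_eq[of \<pi> d p] inj_affine_points[of \<pi> d p] assms by (simp add: card_image)

section \<open>Conics in a plane\<close>

text \<open>If \<open>2 = 0\<close>, the pairs \<open>{x, x + 1}\<close> partition the field, so its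
  order is even.\<close>

lemma two_neq_0_of_odd_card:
  assumes "odd CARD('a::{field,finite})"
  shows "(2::'a) \<noteq> 0"
proof
  assume "(2::'a) = 0"
  then have "(1::'a) + 1 = 0" by simp
  then have inv: "x + 1 + 1 = x" for x :: 'a by (simp add: add.assoc)
  have "2 * card (range (\<lambda>x::'a. {x, x + 1})) = card (\<Union>(range (\<lambda>x::'a. {x, x + 1})))"
    by (rule card_partition) (auto simp: inv)
  also have "\<Union>(range (\<lambda>x::'a. {x, x + 1})) = UNIV" by auto
  finally show False using assms by (metis dvd_triv_left)
qed

text \<open>Each square has at most two roots, and 0 has only one; this makes the inequality
  strict.\<close>

lemma card_squares:
  "CARD('a::{field,finite}) < 2 * card (range (\<lambda>x::'a. x\<^sup>2))"
proof -
  let ?S = "range (\<lambda>x::'a. x\<^sup>2)"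
  let ?F = "\<lambda>s. {x::'a. x\<^sup>2 = s}"
  have "card (?F s) \<le> (if s = 0 then 1 else 2)" for s
  proof (cases "?F s = {}")
    case False
    then obtain x where x: "x\<^sup>2 = s" by blast
    have "?F s = {x, -x}" using x by (auto simp: power2_eq_iff)
    then show ?thesis using x card_insert_le_m1[of 2 "{-x}" x] by auto
  qed auto
  then have "(\<Sum>s\<in>?S. card (?F s)) \<le> (\<Sum>s\<in>?S. (if s = 0 then 1 else 2))"
    by (rule sum_mono)
  also have "\<dots> = (\<Sum>s\<in>insert 0 (?S - {0}). (if s = 0 then 1 else 2))"
    by (rule sum.cong) (auto intro: rangeI[of "\<lambda>x::'a. x\<^sup>2" 0, simplified])
  also have "\<dots> = 1 + 2 * (card ?S - 1)"
  proof -
    have "0 \<in> ?S" using rangeI[of "\<lambda>x::'a. x\<^sup>2" 0] by simp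
    moreover have "(\<Sum>s\<in>?S - {0}. if s = 0 then 1 else 2) = (\<Sum>s\<in>?S - {0}. 2::nat)"
      by (rule sum.cong) auto
    ultimately show ?thesis by (simp add: sum.insert_remove card_Diff_singleton)
  qed
  also have "\<dots> < 2 * card ?S"
    using card_gt_0_iff[of ?S] by simp
  also have "(\<Sum>s\<in>?S. card (?F s)) = card (\<Union>s\<in>?S. ?F s)"
    by (rule card_UN_disjoint[symmetric]) auto
  also have "(\<Union>s\<in>?S. ?F s) = UNIV" by auto
  finally show ?thesis by simp
qed

text \<open>Pigeonhole: the values of \<open>a x\<^sup>2\<close> and of
  \<open>- (b y\<^sup>2 + c)\<close> each fill more than half of the field, so they have one in
  common.\<close>

lemma two_squares_represent:
  fixes a b c :: "'a::{field,finite}"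
  assumes "a \<noteq> 0" "b \<noteq> 0"
  obtains x y where "a * x\<^sup>2 + b * y\<^sup>2 + c = 0"
proof -
  let ?S = "range (\<lambda>x::'a. x\<^sup>2)"
  let ?A = "(\<lambda>s. a * s) ` ?S" and ?B = "(\<lambda>s. - (b * s + c)) ` ?S"
  have "card ?A = card ?S" "card ?B = card ?S"
    using assms by (auto intro!: card_image inj_onI)
  moreover have "card (?A \<union> ?B) \<le> CARD('a)" by (rule card_mono) auto
  moreover have "card ?A + card ?B = card (?A \<union> ?B) + card (?A \<inter> ?B)"
    by (rule card_Un_Int) auto
  ultimately have "card (?A \<inter> ?B) \<noteq> 0"
    using card_squares[where ?'a = 'a] by linarith
  then have "?A \<inter> ?B \<noteq> {}" by (metis card.empty)
  then obtain x y where "a * x\<^sup>2 = - (b * y\<^sup>2 + c)" by auto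
  then have "a * x\<^sup>2 + b * y\<^sup>2 + c = 0" by (simp add: eq_neg_iff_add_eq_0 add.assoc)
  then show thesis by (rule that)
qed

section \<open>Quadratic forms and their polar forms\<close>

lemma quad_form_scale: "quad_form M (c *s v) = c\<^sup>2 * quad_form M v"
  by (simp add: quad_form_def sum_distrib_left power2_eq_square mult_ac)

lemma polar_form_explicit:
  "polar_form M v w = (\<Sum>i\<in>UNIV. \<Sum>j\<in>UNIV. M $ i $ j * (v $ i * w $ j + w $ i * v $ j))"
  by (simp add: polar_form_def quad_form_def sum_subtractf[symmetric] algebra_simps)

lemma polar_form_commute: "polar_form M v w = polar_form M w v"
  by (simp add: polar_form_def add.commute)

lemma polar_form_add: "polar_form M (u + v) w = polar_form M u w + polar_form M v w"
  by (simp add: polar_form_explicit sum.distrib[symmetric] algebra_simps)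

lemma polar_form_scale: "polar_form M (c *s v) w = c * polar_form M v w"
  by (simp add: polar_form_explicit sum_distrib_left algebra_simps)

lemma polar_form_add_right: "polar_form M w (u + v) = polar_form M w u + polar_form M w v"
  using polar_form_add polar_form_commute by metis

lemma polar_form_scale_right: "polar_form M w (c *s v) = c * polar_form M w v"
  using polar_form_scale polar_form_commute by metis

lemma polar_form_diff: "polar_form M (u - v) w = polar_form M u w - polar_form M v w"
  using polar_form_add[of M "u - v" v w] by simp

lemma quad_form_add: "quad_form M (v + w) = quad_form M v + quad_form M w + polar_form M v w"
  by (simp add: polar_form_def)

lemma polar_form_diff_right: "polar_form M w (u - v) = polar_form M w u - polar_form M w v"
  using polar_form_diff polar_form_commute by metis

lemma quad_form_diff: "quad_form M (v - w) = quad_form M v + quad_form M w - polar_form M v w"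
  using quad_form_add[of M v "(-1) *s w"] by (simp only: quad_form_scale polar_form_scale_right) simp

lemma polar_form_self: "polar_form M v v = 2 * quad_form M v"
proof -
  have "v + v = 2 *s v" by (metis vec.scale_left_distrib vec.scale_one one_add_one)
  then show ?thesis by (simp add: polar_form_def quad_form_scale power2_eq_square)
qed

lemmas quad_simps = quad_form_scale quad_form_add polar_form_add polar_form_scale
  polar_form_add_right polar_form_scale_right polar_form_diff polar_form_diff_right quad_form_diff

section \<open>The points of a non-singular conic\<close>

locale conic =
  fixes \<pi> :: "('a::{field,finite} ^ 4) set" and M :: "'a ^ 4 ^ 4" and C :: "('a ^ 4) set set"
  assumes plane: "\<pi> \<in> pg_planes"
    and two: "(2::'a) \<noteq> 0"
    and nonsing: "\<And>v. v \<in> \<pi> \<Longrightarrow> v \<noteq> 0 \<Longrightarrow> quad_form M v = 0 \<Longrightarrow> \<exists>w\<in>\<pi>. polar_form M v w \<noteq> 0"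
    and C_eq: "C = {P \<in> pg_points. P \<subseteq> \<pi> \<and> (\<forall>v\<in>P. quad_form M v = 0)}"
begin

abbreviation "f \<equiv> quad_form M"
abbreviation "\<beta> \<equiv> polar_form M"

lemma subspace_plane: "vec.subspace \<pi>"
  using plane by (simp add: pg_planes_def)

lemmas plane_closed = vec.subspace_add[OF subspace_plane] vec.subspace_scale[OF subspace_plane]
  vec.subspace_diff[OF subspace_plane]

lemma span_in_C_iff: "v \<noteq> 0 \<Longrightarrow> vec.span {v} \<in> C \<longleftrightarrow> v \<in> \<pi> \<and> f v = 0"
  unfolding C_eq using span1_subset_iff[OF subspace_plane, of v] vec.span_base[of v "{v}"]
  by (auto simp: pg_points_iff in_span1 quad_form_scale)

lemma C_iff: "P \<in> C \<longleftrightarrow> (\<exists>v. v \<noteq> 0 \<and> v \<in> \<pi> \<and> f v = 0 \<and> P = vec.span {v})"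
proof
  assume P: "P \<in> C"
  then obtain v where v: "v \<noteq> 0" "P = vec.span {v}" by (auto simp: C_eq pg_points_iff)
  with P span_in_C_iff show "\<exists>v. v \<noteq> 0 \<and> v \<in> \<pi> \<and> f v = 0 \<and> P = vec.span {v}" by blast
qed (use span_in_C_iff in blast)

lemma C_points: "C \<subseteq> pg_points" by (auto simp: C_eq)

text \<open>Non-singularity in the form in which it is applied: an isotropic vector orthogonal to a
  basis of the plane is orthogonal to the whole plane.\<close>

lemma eq_0_if_orthogonal_basis:
  assumes "x \<in> \<pi>" "y \<in> \<pi>" "z \<in> \<pi>" "indep2 x y" "z \<notin> vec.span {x, y}"
    and "v \<in> \<pi>" "f v = 0" "\<beta> v x = 0" "\<beta> v y = 0" "\<beta> v z = 0"
  shows "v = 0"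
proof (rule ccontr)
  assume "v \<noteq> 0"
  with nonsing assms obtain w where w: "w \<in> \<pi>" "\<beta> v w \<noteq> 0" by blast
  from w(1) obtain a b c where "w = a *s x + b *s y + c *s z"
    unfolding plane_eq_span3[OF plane assms(1-5)] in_span3 by blast
  then show False using w assms by (simp add: quad_simps)
qed

text \<open>Otherwise Gram-Schmidt works without obstruction and gives an orthogonal basis
  \<open>v\<close>, \<open>w\<close>, \<open>u\<close> of the plane. In it the form is diagonal, and
  \<open>two_squares_represent\<close> yields a zero with coefficient 1 at \<open>u\<close>, hence a
  nonzero vector.\<close>

lemma exists_isotropic: obtains p where "p \<in> \<pi>" "p \<noteq> 0" "f p = 0"
proof (rule ccontr)
  note that' = that
  assume contr: "\<not> thesis"
  have aniso: "f v \<noteq> 0" if "v \<in> \<pi>" "v \<noteq> 0" for v using that' contr that by blast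
  obtain v where v: "v \<in> \<pi>" "v \<notin> vec.span {0, 0}" using plane_diff_span2[OF plane] .
  then have v0: "v \<noteq> 0" using vec.span_zero by metis
  obtain w' where w': "w' \<in> \<pi>" "w' \<notin> vec.span {v, v}" using plane_diff_span2[OF plane] .
  have fv: "f v \<noteq> 0" using aniso v v0 by blast
  \<comment> \<open>The usual projection coefficient; its denominator comes from
    \<open>\<beta> x x = 2 f x\<close>, so odd characteristic matters.\<close>
  have orth: "\<exists>c. \<beta> x (y - c *s x) = 0" if "f x \<noteq> 0" for x y
    by (rule exI[of _ "\<beta> x y / (2 * f x)"])
      (simp only: polar_form_diff_right polar_form_scale_right polar_form_self, simp add: two that)
  obtain c where c: "\<beta> v (w' - c *s v) = 0" using orth[OF fv] by blast
  define w where "w = w' - c *s v"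
  have vw: "\<beta> v w = 0" using c by (simp add: w_def)
  have w: "w \<in> \<pi>" using v w' by (simp add: w_def plane_closed)
  have w0: "w \<noteq> 0"
    using w'(2) in_span1[of w' v] by (auto simp: w_def)
  have fw: "f w \<noteq> 0" using aniso w w0 by blast
  obtain u' where u': "u' \<in> \<pi>" "u' \<notin> vec.span {v, w}" using plane_diff_span2[OF plane] .
  obtain a where a: "\<beta> v (u' - a *s v) = 0" using orth[OF fv] by blast
  obtain b where b: "\<beta> w (u' - b *s w) = 0" using orth[OF fw] by blast
  define u where "u = u' - a *s v - b *s w"
  have u: "u \<in> \<pi>" using v w u' by (simp add: u_def plane_closed)
  have vu: "\<beta> v u = 0"
    using a vw by (simp add: u_def polar_form_diff_right polar_form_scale_right)
  have wu: "\<beta> w u = 0"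
    using b vw by (simp add: u_def polar_form_diff_right polar_form_scale_right polar_form_commute[of M w v])
  obtain x y where xy: "f v * x\<^sup>2 + f w * y\<^sup>2 + f u = 0"
    using two_squares_represent[OF fv fw] .
  have "f (x *s v + y *s w + u) = 0"
    using xy vw vu wu by (simp add: quad_simps mult_ac)
  moreover have "x *s v + y *s w + u \<in> \<pi>" using v w u by (simp add: plane_closed)
  ultimately have "x *s v + y *s w + u = 0" using aniso by blast
  \<comment> \<open>A zero combination would put \<open>u\<close>, and with it \<open>u'\<close>, in
    the span of \<open>v\<close> and \<open>w\<close>.\<close>
  then have "u = - (x *s v + y *s w)" by (metis eq_neg_iff_add_eq_0 add.commute)
  moreover have "u' = u + a *s v + b *s w" by (simp add: u_def)
  ultimately have "u' = (a - x) *s v + (b - y) *s w"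
    by (simp add: vec.scale_left_diff_distrib)
  then show False using u'(2) unfolding in_span2 by blast
qed

text \<open>The conic contains no line. If \<open>\<beta> x y = 0\<close>, all combinations of
  \<open>x\<close> and \<open>y\<close> are isotropic and orthogonal to both; the combination
  \<open>v\<close> is also orthogonal to a third basis vector \<open>u\<close>, so it vanishes. Then
  \<open>\<beta> x u = 0\<close>, which makes \<open>x\<close> itself orthogonal to the
  plane.\<close>

lemma polar_neq_0:
  assumes "x \<in> \<pi>" "y \<in> \<pi>" "f x = 0" "f y = 0" "indep2 x y"
  shows "\<beta> x y \<noteq> 0"
proof
  assume b: "\<beta> x y = 0"
  obtain u where u: "u \<in> \<pi>" "u \<notin> vec.span {x, y}" using plane_diff_span2[OF plane] .
  define v where "v = \<beta> y u *s x + (- \<beta> x u) *s y"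
  have "v = 0"
    by (rule eq_0_if_orthogonal_basis[OF assms(1,2) u(1) assms(5) u(2)])
      (use assms b u in \<open>auto simp: v_def plane_closed quad_simps polar_form_self polar_form_commute[of M y x]\<close>)
  then have "\<beta> x u = 0" using assms(5) unfolding v_def indep2_def by fastforce
  have "x = 0"
    by (rule eq_0_if_orthogonal_basis[OF assms(1,2) u(1) assms(5) u(2)])
      (use assms b u \<open>\<beta> x u = 0\<close> in \<open>auto simp: polar_form_self\<close>)
  then show False using assms(5) indep2_iff indep2_commute by metis
qed

text \<open>No three points of the conic are collinear: \<open>z = a x + b y\<close> gives
  \<open>f z = a b \<beta> x y\<close>, and the last factor is nonzero, so \<open>z\<close> would be
  a multiple of \<open>x\<close> or of \<open>y\<close>.\<close>

lemma C_indep3: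
  assumes "vec.span {x} \<in> C" "vec.span {y} \<in> C" "vec.span {z} \<in> C" "x \<noteq> 0" "y \<noteq> 0" "z \<noteq> 0"
    and "vec.span {x} \<noteq> vec.span {y}" "vec.span {y} \<noteq> vec.span {z}" "vec.span {x} \<noteq> vec.span {z}"
  shows "indep3 x y z"
proof (rule indep3I)
  have *: "x \<in> \<pi>" "y \<in> \<pi>" "z \<in> \<pi>" "f x = 0" "f y = 0" "f z = 0"
    using assms span_in_C_iff by auto
  have in_span: "v \<in> vec.span {v}" for v :: "'a ^ 4" by (simp add: vec.span_base)
  show xy: "indep2 x y" 
    using assms(1,2) C_points assms(4-7) in_span by (intro distinct_points_indep2) auto
  show "z \<notin> vec.span {x, y}"
  proof
    assume "z \<in> vec.span {x, y}"
    then obtain a b where z: "z = a *s x + b *s y" unfolding in_span2 by blast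
    then have "a * b * \<beta> x y = 0" using * by (auto simp: quad_simps)
    then have "a = 0 \<or> b = 0" using polar_neq_0[OF *(1,2,4,5) xy] by simp
    then show False
    proof
      assume "a = 0" then show False
        using span1_eq_iff[of y z] z assms by (cases "b = 0") auto
    next
      assume "b = 0" then show False
        using span1_eq_iff[of x z] z assms by (cases "a = 0") auto
    qed
  qed
qed

text \<open>In a basis of isotropic \<open>p\<close>, \<open>r\<close> and a vector \<open>u\<close>
  orthogonal to both, the form is \<open>a b \<beta> p r + c\<^sup>2 f u\<close>. Its zeros are the
  point of \<open>r\<close> and one point \<open>g s\<close> with \<open>a = 1\<close>,
  \<open>c = s\<close> for each field element \<open>s\<close>.\<close>

lemma card_C: "card C = CARD('a) + 1"
proof -
  obtain p where p: "p \<in> \<pi>" "p \<noteq> 0" "f p = 0" using exists_isotropic .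
  then obtain w where w: "w \<in> \<pi>" "\<beta> p w \<noteq> 0" using nonsing by blast
  \<comment> \<open>A multiple of \<open>p\<close> is added to \<open>w\<close> to make it
    isotropic; \<open>\<beta> p r = \<beta> p w\<close> stays nonzero because \<open>p\<close> is
    isotropic.\<close>
  define r where "r = w + (- (f w / \<beta> p w)) *s p"
  have r: "r \<in> \<pi>" "f r = 0" 
    using p w by (auto simp: r_def plane_closed quad_simps polar_form_commute[of M w p])
  have pr: "\<beta> p r \<noteq> 0" using p w by (simp add: r_def quad_simps polar_form_self)
  have ipr: "indep2 p r"
  proof -
    have "r \<noteq> 0" using pr polar_form_scale_right[of M p 0 r] by auto
    moreover have "p \<noteq> k *s r" for k using pr r by (auto simp: quad_simps polar_form_self)
    ultimately show ?thesis by (simp add: indep2_iff in_span1)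
  qed
  then have r0: "r \<noteq> 0" by (simp add: indep2_iff)
  obtain u' where u': "u' \<in> \<pi>" "u' \<notin> vec.span {p, r}" using plane_diff_span2[OF plane] .
  \<comment> \<open>The component of \<open>u'\<close> in the span of \<open>p\<close> and
    \<open>r\<close> is subtracted, which leaves a vector orthogonal to both.\<close>
  define u where "u = u' + (- (\<beta> r u' / \<beta> p r)) *s p + (- (\<beta> p u' / \<beta> p r)) *s r"
  have u: "u \<in> \<pi>" using p r u' by (simp add: u_def plane_closed)
  have u_span: "u \<notin> vec.span {p, r}"
  proof
    assume "u \<in> vec.span {p, r}"
    then have "u - (- (\<beta> r u' / \<beta> p r)) *s p - (- (\<beta> p u' / \<beta> p r)) *s r \<in> vec.span {p, r}"
      by (intro vec.span_diff vec.span_scale) (auto intro: vec.span_base)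
    then show False using u' by (simp add: u_def)
  qed
  have pu: "\<beta> p u = 0" "\<beta> r u = 0"
    using p r pr by (auto simp: u_def quad_simps polar_form_self polar_form_commute[of M r p])
  have fu: "f u \<noteq> 0"
  proof
    assume "f u = 0"
    then have "u = 0"
      using eq_0_if_orthogonal_basis[OF p(1) r(1) u ipr u_span u] pu
      by (simp add: polar_form_commute[of M u] polar_form_self)
    then show False using u_span vec.span_zero by metis
  qed
  have pi: "\<pi> = vec.span {p, r, u}" using plane_eq_span3[OF plane p(1) r(1) u ipr u_span] .
  have i3: "indep3 p r u" using indep3I[OF ipr u_span] .
  define g where "g s = p + (- (s\<^sup>2 * f u / \<beta> p r)) *s r + s *s u" for s
  have g0: "g s \<noteq> 0" for s
    using i3[unfolded indep3_def, rule_format, of 1 "- (s\<^sup>2 * f u / \<beta> p r)" s] by (auto simp: g_def)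
  have form: "f (a *s p + b *s r + c *s u) = a * b * \<beta> p r + c\<^sup>2 * f u" for a b c
    using p r pu by (simp add: quad_simps)
  have fg: "f (g s) = 0" for s using form[of 1 "- (s\<^sup>2 * f u / \<beta> p r)" s] pr by (simp add: g_def)
  have gpi: "g s \<in> \<pi>" for s using p r u by (simp add: g_def plane_closed)
  have "C = insert (vec.span {r}) (range (\<lambda>s. vec.span {g s}))"
  proof (intro equalityI subsetI)
    fix P assume "P \<in> C"
    then obtain v where v: "v \<noteq> 0" "v \<in> \<pi>" "f v = 0" "P = vec.span {v}" unfolding C_iff by blast
    then obtain a b c where abc: "v = a *s p + b *s r + c *s u" unfolding pi in_span3 by blast
    have e: "a * b * \<beta> p r + c\<^sup>2 * f u = 0" using form v abc by simp
    show "P \<in> insert (vec.span {r}) (range (\<lambda>s. vec.span {g s}))"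
    proof (cases "a = 0")
      case True
      then have "c = 0" using e fu by simp
      then have "v = b *s r" "b \<noteq> 0" using abc True v by auto
      then have "P = vec.span {r}" using span1_eq_iff[OF r0] v by metis
      then show ?thesis by simp
    next
      case False
      have b: "b = - (a * ((c / a)\<^sup>2 * f u / \<beta> p r))"
        using e False pr by (simp add: field_simps power2_eq_square eq_neg_iff_add_eq_0)
      have "v = a *s g (c / a)"
        using False unfolding abc b g_def by (simp add: vec.scale_right_distrib vec.scale_right_diff_distrib)
      then have "P = vec.span {g (c / a)}" using span1_eq_iff[OF g0] False v by metis
      then show ?thesis by simp
    qed
  next
    fix P assume "P \<in> insert (vec.span {r}) (range (\<lambda>s. vec.span {g s}))"
    then show "P \<in> C" using span_in_C_iff[OF g0] span_in_C_iff[OF r0] fg gpi r by auto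
  qed
  moreover have "inj (\<lambda>s. vec.span {g s})"
  proof (rule injI)
    fix s t assume "vec.span {g s} = vec.span {g t}"
    then obtain k where k: "g t = k *s g s" using span1_eq_iff[OF g0] by blast
    then have "(1 - k) *s p + (k * (s\<^sup>2 * f u / \<beta> p r) - t\<^sup>2 * f u / \<beta> p r) *s r + (t - k * s) *s u = 0"
      by (simp add: g_def vec.scale_right_distrib algebra_simps)
    then have "1 - k = 0" "t - k * s = 0" using i3 unfolding indep3_def by blast+
    then show "s = t" by simp
  qed
  moreover have "vec.span {r} \<noteq> vec.span {g s}" for s
  proof
    assume "vec.span {r} = vec.span {g s}"
    then obtain k where k: "g s = k *s r" using span1_eq_iff[OF r0] by blast
    then have "1 *s p + (- (s\<^sup>2 * f u / \<beta> p r) - k) *s r + s *s u = 0"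
      by (simp add: g_def algebra_simps)
    then show False using i3 unfolding indep3_def by (metis zero_neq_one)
  qed
  ultimately show ?thesis by (subst \<open>C = _\<close>, subst card_insert_disjoint) (auto simp: card_image)
qed

end

section \<open>The rulings of a hyperbolic quadric\<close>

lemma pg_lineE:
  assumes "l \<in> pg_lines"
  obtains x y where "indep2 x y" "l = vec.span {x, y}"
proof -
  have l: "vec.subspace l" "vec.dim l = 2" using assms by (auto simp: pg_lines_def)
  have "\<not> l \<subseteq> {0}" using vec.dim_eq_0[of l] l by simp
  then obtain y where y: "y \<in> l" "y \<noteq> 0" by auto
  have "vec.dim (vec.span {y}) \<le> 1" by simp
  then have "\<not> l \<subseteq> vec.span {y}"
    using vec.dim_subset[of l "vec.span {y}"] l by linarith
  then obtain x where x: "x \<in> l" "x \<notin> vec.span {y}" by auto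
  with y have "indep2 x y" by (simp add: indep2_iff)
  with that pg_line_eq_span[OF assms] x y show thesis by blast
qed

abbreviation std_form :: "'a::field ^ 4 \<Rightarrow> 'a" where
  "std_form v \<equiv> v $ 1 * v $ 2 + v $ 3 * v $ 4"

text \<open>
  The two reguli of the standard quadric are \<open>std_ruling 3 4\<close> and \<open>std_ruling 4 3\<close>, parametrised by
  the projective line \<open>'a option\<close>, with \<open>None\<close> as the point at infinity.
\<close>

definition std_ruling :: "4 \<Rightarrow> 4 \<Rightarrow> 'a::field option \<Rightarrow> ('a ^ 4) set" where
  "std_ruling i j t = (case t of None \<Rightarrow> {v. v $ i = 0 \<and> v $ 2 = 0}
    | Some s \<Rightarrow> {v. v $ 1 = s * v $ i \<and> v $ j = - (s * v $ 2)})"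

lemma vec4_eq_iff: "(v :: 'a ^ 4) = w \<longleftrightarrow> v $ 1 = w $ 1 \<and> v $ 2 = w $ 2 \<and> v $ 3 = w $ 3 \<and> v $ 4 = w $ 4"
  by (simp add: vec_eq_iff forall_4)

lemma std_ruling_subspace: "vec.subspace (std_ruling i j t)"
  by (auto simp: vec.subspace_def std_ruling_def algebra_simps split: option.split)

text \<open>Exchanging coordinates 3 and 4 preserves \<open>std_form\<close>; the indices
  \<open>i\<close> and \<open>j\<close> let one argument serve both reguli.\<close>

lemma std_ruling_line:
  assumes "(i, j) \<in> {(3, 4), (4, 3)}"
  shows "std_ruling i j t \<in> pg_lines"
proof -
  define x y :: "'a ^ 4" where
    "x = (case t of None \<Rightarrow> axis 1 1 | Some s \<Rightarrow> (\<chi> k. if k = 1 then s else if k = i then 1 else 0))"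
    and "y = (case t of None \<Rightarrow> axis j 1 | Some s \<Rightarrow> (\<chi> k. if k = 2 then 1 else if k = j then - s else 0))"
  have ind: "indep2 x y"
    using assms by (cases t) (auto simp: indep2_def x_def y_def vec4_eq_iff axis_def)
  have "std_ruling i j t = vec.span {x, y}"
  proof (intro equalityI subsetI)
    fix v assume v: "v \<in> std_ruling i j t"
    define a b where "a = (if t = None then v $ 1 else v $ i)" and "b = (if t = None then v $ j else v $ 2)"
    have "i = 3 \<and> j = 4 \<or> i = 4 \<and> j = 3" using assms by auto
    then have "v = a *s x + b *s y"
      using v
      by (cases t; elim disjE; simp add: x_def y_def a_def b_def vec4_eq_iff axis_def std_ruling_def)
    then show "v \<in> vec.span {x, y}" unfolding in_span2 by blast
  next
    have "{x, y} \<subseteq> std_ruling i j t"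
      using assms by (cases t) (auto simp: x_def y_def axis_def std_ruling_def)
    then show "v \<in> std_ruling i j t" if "v \<in> vec.span {x, y}" for v
      using that vec.span_minimal[OF _ std_ruling_subspace] by blast
  qed
  with ind show ?thesis using pg_linesI by simp
qed

lemma std_ruling_isotropic:
  assumes "(i, j) \<in> {(3, 4), (4, 3)}" "v \<in> std_ruling i j t"
  shows "std_form v = 0"
  using assms by (cases t) (auto simp: std_ruling_def)

lemma std_ruling_disjoint:
  assumes "(i, j) \<in> {(3, 4), (4, 3)}" "t \<noteq> t'" "v \<in> std_ruling i j t" "v \<in> std_ruling i j t'"
  shows "v = 0"
proof -
  have ij: "i = 3 \<and> j = 4 \<or> i = 4 \<and> j = 3" using assms by auto
  have "v $ 1 = 0 \<and> v $ 2 = 0 \<and> v $ i = 0 \<and> v $ j = 0"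
  proof (cases t; cases t')
    fix s s' assume t: "t = Some s" "t' = Some s'"
    then have e: "v $ 1 = s * v $ i" "v $ j = - (s * v $ 2)" "s * v $ i = s' * v $ i" "s * v $ 2 = s' * v $ 2"
      using assms(3,4) by (simp_all add: std_ruling_def)
    moreover have "s \<noteq> s'" using t assms(2) by simp
    ultimately have "v $ i = 0" "v $ 2 = 0" by auto
    then show ?thesis using e by simp
  qed (use assms(2-4) in \<open>simp_all add: std_ruling_def\<close>)
  then show ?thesis using ij unfolding vec4_eq_iff by auto
qed

lemma std_ruling_meet:
  obtains v where "v \<noteq> 0" "v \<in> std_ruling 3 4 t" "v \<in> std_ruling 4 3 t'"
proof (cases t; cases t')
  assume "t = None" "t' = None"
  then show thesis by (intro that[of "axis 1 1"]) (auto simp: std_ruling_def axis_def vec4_eq_iff)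
next
  fix s assume "t = None" "t' = Some s"
  then show thesis
    by (intro that[of "\<chi> k. if k = 1 then s else if k = 4 then 1 else 0"])
      (auto simp: std_ruling_def vec4_eq_iff)
next
  fix s assume "t = Some s" "t' = None"
  then show thesis
    by (intro that[of "\<chi> k. if k = 1 then s else if k = 3 then 1 else 0"])
      (auto simp: std_ruling_def vec4_eq_iff)
next
  fix s s' assume "t = Some s" "t' = Some s'"
  \<comment> \<open>With second coordinate 1, the equations of the two lines force third coordinate
    \<open>- s'\<close>, fourth \<open>- s\<close> and first \<open>- (s * s')\<close>.\<close>
  then show thesis
    by (intro that[of "\<chi> k. if k = 1 then - (s * s') else if k = 2 then 1 else if k = 3 then - s' else - s"])
      (auto simp: std_ruling_def vec4_eq_iff)
qed

text \<open>The point of \<open>v\<close> lies on one line of each ruling, and \<open>l\<close> must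
  be one of the two. If coordinates 1 and \<open>i\<close> vanish on all of \<open>l\<close>, it is
  the line of \<open>std_ruling j i\<close> with parameter 0. Otherwise orthogonality to
  \<open>v\<close> forces \<open>l\<close> to be the line of \<open>std_ruling i j\<close> through
  \<open>v\<close>.\<close>

lemma isotropic_line_in_ruling:
  assumes ij: "(i, j) \<in> {(3, 4), (4, 3)}"
    and l: "l \<in> pg_lines" "\<And>v. v \<in> l \<Longrightarrow> std_form v = 0"
    and v: "v \<in> l" "v \<noteq> 0" "v $ 1 = 0" "v $ i = 0"
  shows "l \<in> range (std_ruling i j) \<union> range (std_ruling j i)"
proof -
  have subspace: "vec.subspace l" and dim: "vec.dim l = 2" using l by (auto simp: pg_lines_def)
  have ji: "(j, i) \<in> {(3, 4), (4, 3)}" using ij by auto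
  have N: "std_form w = w $ 1 * w $ 2 + w $ i * w $ j" for w :: "'a ^ 4"
    using ij by (auto simp: mult.commute)
  have subset: "l \<subseteq> std_ruling i' j' t \<Longrightarrow> l = std_ruling i' j' t" if "(i', j') \<in> {(3, 4), (4, 3)}" for i' j' t
    using std_ruling_line[OF that, of t] dim subspace std_ruling_subspace
    by (intro vec.subspace_dim_equal) (auto simp: pg_lines_def)
  have two_points: "l = std_ruling i j t" if "w \<in> l" "indep2 v w" "v \<in> std_ruling i j t" "w \<in> std_ruling i j t" for w t
    using pg_line_eq_span[OF l(1) v(1) that(1,2)] pg_line_eq_span[OF std_ruling_line[OF ij] that(3,4,2)] by simp
  \<comment> \<open>The polar form of \<open>v\<close> and \<open>w\<close> vanishes because the
    form vanishes at \<open>v\<close>, \<open>w\<close> and \<open>v + w\<close>; the terms with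
    \<open>v $ 1\<close> and \<open>v $ i\<close> drop out.\<close>
  have polar: "w $ 1 * v $ 2 + w $ i * v $ j = 0" if "w \<in> l" for w
  proof -
    have "w $ 1 * v $ 2 + w $ i * v $ j + (w $ 1 * w $ 2 + w $ i * w $ j) = 0"
      using l(2)[OF vec.subspace_add[OF subspace v(1) that]] v(3,4)
      unfolding N by (simp add: algebra_simps)
    then show ?thesis using l(2)[OF that] unfolding N by simp
  qed
  have w_iso: "w $ 1 * w $ 2 + w $ i * w $ j = 0" if "w \<in> l" for w
    using l(2)[OF that] N by simp
  show ?thesis
  proof (cases "\<exists>w\<in>l. w $ 1 \<noteq> 0 \<or> w $ i \<noteq> 0")
    case False
    then have "l \<subseteq> std_ruling j i (Some 0)" by (auto simp: std_ruling_def)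
    then show ?thesis using subset[OF ji] by blast
  next
    case True
    then obtain w where w: "w \<in> l" "w $ 1 \<noteq> 0 \<or> w $ i \<noteq> 0" by blast
    have "w \<noteq> k *s v" for k using w(2) v by auto
    then have ind: "indep2 v w" using v(2) in_span1 indep2_iff indep2_commute by blast
    show ?thesis
    proof (cases "v $ 2 = 0")
      case True
      then have "v $ j \<noteq> 0" using v ij by (auto simp: vec4_eq_iff)
      then have "w $ i = 0" using polar[OF w(1)] True by simp
      then have "w $ 2 = 0" using w w_iso[OF w(1)] by simp
      then have "l = std_ruling i j None"
        using \<open>w $ i = 0\<close> True v by (intro two_points[OF w(1) ind]) (auto simp: std_ruling_def)
      then show ?thesis by blast
    next
      case False
      \<comment> \<open>The parameter of the line of this ruling through \<open>v\<close>, read off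
        from \<open>v $ j = - (s * v $ 2)\<close>.\<close>
      define s where "s = - (v $ j / v $ 2)"
      have w1: "w $ 1 = s * w $ i"
        using polar[OF w(1)] False by (simp add: s_def field_simps eq_neg_iff_add_eq_0)
      then have "w $ i \<noteq> 0" using w by auto
      moreover have "w $ i * (w $ j + s * w $ 2) = 0"
        using w_iso[OF w(1)] by (simp add: w1 algebra_simps)
      ultimately have "w $ j = - (s * w $ 2)" by (simp add: eq_neg_iff_add_eq_0)
      then have "l = std_ruling i j (Some s)"
        using w1 False v by (intro two_points[OF w(1) ind]) (auto simp: std_ruling_def s_def)
      then show ?thesis by blast
    qed
  qed
qed

lemma quadric_lines_std:
  "quadric_lines standard_hyperbolic_quadric = {l \<in> pg_lines. \<forall>v\<in>l. std_form v = (0::'a::field)}"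
proof -
  have "(\<forall>P\<in>pg_points. P \<subseteq> l \<longrightarrow> P \<in> standard_hyperbolic_quadric) \<longleftrightarrow> (\<forall>v\<in>l. std_form v = 0)"
    if "l \<in> pg_lines" for l :: "('a ^ 4) set"
  proof
    assume "\<forall>v\<in>l. std_form v = 0"
    then show "\<forall>P\<in>pg_points. P \<subseteq> l \<longrightarrow> P \<in> standard_hyperbolic_quadric"
      by (auto simp: standard_hyperbolic_quadric_def)
  next
    assume *: "\<forall>P\<in>pg_points. P \<subseteq> l \<longrightarrow> P \<in> standard_hyperbolic_quadric"
    show "\<forall>v\<in>l. std_form v = 0"
    proof
      fix v assume "v \<in> l"
      then show "std_form v = 0"
        using *[rule_format, of "vec.span {v}"] that span1_subset_iff[of l v] vec.span_base[of v "{v}"]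
        by (cases "v = 0") (auto simp: pg_points_iff pg_lines_def standard_hyperbolic_quadric_def)
    qed
  qed
  then show ?thesis by (auto simp: quadric_lines_def)
qed

text \<open>Every line has a point with first coordinate 0. On an isotropic line that point has
  third or fourth coordinate 0, which decides the order of indices for
  \<open>isotropic_line_in_ruling\<close>.\<close>

lemma quadric_lines_std_eq:
  "quadric_lines standard_hyperbolic_quadric = range (std_ruling 3 4) \<union> range (std_ruling 4 3)"
proof (intro equalityI subsetI)
  fix l :: "('a ^ 4) set" assume "l \<in> quadric_lines standard_hyperbolic_quadric"
  then have l: "l \<in> pg_lines" "\<And>v. v \<in> l \<Longrightarrow> std_form v = 0" unfolding quadric_lines_std by auto
  obtain x y where xy: "indep2 x y" "l = vec.span {x, y}" using pg_lineE[OF l(1)] .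
  have "\<exists>v\<in>l. v \<noteq> 0 \<and> v $ 1 = 0"
  proof (cases "x $ 1 = 0")
    case True
    moreover have "x \<noteq> 0" using xy(1) indep2_iff indep2_commute by blast
    moreover have "x \<in> l" unfolding xy by (simp add: vec.span_base)
    ultimately show ?thesis by blast
  next
    case False
    let ?v = "(- y $ 1) *s x + x $ 1 *s y"
    have "?v \<in> l" unfolding xy in_span2 by blast
    moreover have "?v \<noteq> 0" using xy(1) False unfolding indep2_def by blast
    ultimately show ?thesis by (intro bexI[of _ ?v]) auto
  qed
  then obtain v where v: "v \<in> l" "v \<noteq> 0" "v $ 1 = 0" by blast
  then have "v $ 3 = 0 \<or> v $ 4 = 0" using l(2)[of v] by simp
  then show "l \<in> range (std_ruling 3 4) \<union> range (std_ruling 4 3)"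
    using isotropic_line_in_ruling[of 3 4 l v] isotropic_line_in_ruling[of 4 3 l v] l v by auto
next
  fix l :: "('a ^ 4) set" assume "l \<in> range (std_ruling 3 4) \<union> range (std_ruling 4 3)"
  then show "l \<in> quadric_lines standard_hyperbolic_quadric"
    unfolding quadric_lines_std using std_ruling_line std_ruling_isotropic by fast
qed

lemma meets_iff: 
  assumes "vec.subspace l" "vec.subspace m"
  shows "meets l m \<longleftrightarrow> (\<exists>v. v \<noteq> 0 \<and> v \<in> l \<and> v \<in> m)"
  unfolding meets_def
proof
  assume "\<exists>P\<in>pg_points. P \<subseteq> l \<and> P \<subseteq> m"
  then obtain P where "P \<in> pg_points" "P \<subseteq> l" "P \<subseteq> m" by blast
  moreover then obtain v where "v \<noteq> 0" "P = vec.span {v}" unfolding pg_points_iff by blast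
  ultimately have "v \<noteq> 0" "vec.span {v} \<subseteq> l" "vec.span {v} \<subseteq> m" by auto
  then show "\<exists>v. v \<noteq> 0 \<and> v \<in> l \<and> v \<in> m"
    using span1_subset_iff[OF assms(1)] span1_subset_iff[OF assms(2)] by blast
next
  assume "\<exists>v. v \<noteq> 0 \<and> v \<in> l \<and> v \<in> m"
  then obtain v where v: "v \<noteq> 0" "v \<in> l" "v \<in> m" by blast
  then have "vec.span {v} \<in> pg_points" "vec.span {v} \<subseteq> l" "vec.span {v} \<subseteq> m"
    using span1_subset_iff[OF assms(1)] span1_subset_iff[OF assms(2)] unfolding pg_points_iff by blast+
  then show "\<exists>P\<in>pg_points. P \<subseteq> l \<and> P \<subseteq> m" by blast
qed

lemma pg_line_nonzero:
  assumes "l \<in> pg_lines"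
  obtains v where "v \<in> l" "v \<noteq> 0"
proof -
  obtain x y where xy: "indep2 x y" "l = vec.span {x, y}" using pg_lineE[OF assms] .
  then have "y \<noteq> 0" "y \<in> l" by (simp_all add: indep2_iff vec.span_base)
  with that show thesis by blast
qed

lemma card_std_ruling:
  assumes "(i, j) \<in> {(3, 4), (4, 3)}"
  shows "card (range (std_ruling i j :: 'a::{field,finite} option \<Rightarrow> _)) = CARD('a) + 1"
proof -
  have "inj (std_ruling i j :: 'a option \<Rightarrow> _)"
  proof (rule injI, rule ccontr)
    fix t t' :: "'a option" assume t: "std_ruling i j t = std_ruling i j t'" "t \<noteq> t'"
    obtain v where "v \<in> std_ruling i j t" "v \<noteq> 0"
      using pg_line_nonzero[OF std_ruling_line[OF assms]] .
    then show False using std_ruling_disjoint[OF assms t(2)] t(1) by blast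
  qed
  then show ?thesis by (simp add: card_image card_UNIV_option)
qed

lemma reguli_std:
  "reguli (standard_hyperbolic_quadric :: ('a::{field,finite} ^ 4) set set)
     (range (std_ruling 3 4)) (range (std_ruling 4 3))"
proof -
  have disj: "\<not> meets l m" if "(i, j) \<in> {(3, 4), (4, 3)}" "l \<noteq> m"
    "l \<in> range (std_ruling i j)" "m \<in> range (std_ruling i j)" for i j and l m :: "('a ^ 4) set"
  proof -
    from that(3,4) obtain t t' where t: "l = std_ruling i j t" "m = std_ruling i j t'" by blast
    then have "t \<noteq> t'" using that(2) by blast
    then show ?thesis
      using std_ruling_disjoint[OF that(1)] unfolding t meets_iff[OF std_ruling_subspace std_ruling_subspace]
      by blast
  qed
  have meet: "meets l m" if "l \<in> range (std_ruling 3 4)" "m \<in> range (std_ruling 4 3)" for l m :: "('a ^ 4) set"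
  proof -
    from that obtain t t' where t: "l = std_ruling 3 4 t" "m = std_ruling 4 3 t'" by blast
    show ?thesis unfolding t meets_iff[OF std_ruling_subspace std_ruling_subspace]
      using std_ruling_meet[of t t'] by blast
  qed
  \<comment> \<open>A common line \<open>l\<close> would meet every other line \<open>m\<close> of
    the first ruling, as a member of the second, and also be disjoint from it.\<close>
  have "range (std_ruling 3 4) \<inter> range (std_ruling 4 3) = ({} :: ('a ^ 4) set set)"
  proof (rule ccontr)
    assume "range (std_ruling 3 4) \<inter> range (std_ruling 4 3) \<noteq> ({} :: ('a ^ 4) set set)"
    then obtain l :: "('a ^ 4) set" where l: "l \<in> range (std_ruling 3 4)" "l \<in> range (std_ruling 4 3)" by blast
    have "card (range (std_ruling 3 4) :: ('a ^ 4) set set) \<noteq> 1"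
      using card_std_ruling[of 3 4, where ?'a = 'a] by simp
    then obtain m where "m \<in> range (std_ruling 3 4)" "m \<noteq> l" using l(1)
      by (metis is_singletonI' is_singleton_altdef empty_iff)
    then show False using disj[of 3 4 m l] meet[of m l] l by simp
  qed
  with disj[of 3 4] disj[of 4 3] meet show ?thesis
    unfolding reguli_def quadric_lines_std_eq by (simp add: card_std_ruling)
qed

section \<open>Projectivities and images of the standard quadric\<close>

lemma matrix_image_span2: "(*v) T ` vec.span {x, y} = vec.span {T *v x, T *v y}"
proof -
  have "T *v (a *s x + b *s y) = a *s (T *v x) + b *s (T *v y)" for a b
    by (simp add: matrix_vector_right_distrib vector_scalar_commute)
  then have "v \<in> (*v) T ` vec.span {x, y} \<longleftrightarrow> v \<in> vec.span {T *v x, T *v y}" for v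
    unfolding image_iff Bex_def in_span2 by metis
  then show ?thesis by blast
qed

text \<open>The inverse is a parameter, so that \<open>swap\<close> gives every image lemma for
  \<open>T'\<close> as well and hence the converse implications.\<close>

locale invertible_matrix =
  fixes T T' :: "'a::field ^ 4 ^ 4"
  assumes inv: "T ** T' = mat 1" "T' ** T = mat 1"
begin

lemma swap: "invertible_matrix T' T"
  using inv by unfold_locales

lemma cancel [simp]: "T *v (T' *v x) = x" "T' *v (T *v x) = x"
  by (simp_all add: matrix_vector_mul_assoc inv)

lemma image_cancel: "(*v) T' ` (*v) T ` l = l"
  by (simp add: image_image)

lemma inj: "inj ((*v) T)"
  by (rule inj_on_inverseI[of _ "(*v) T'"]) simp

lemmas matrix_image_eq_iff = inj_image_eq_iff[OF inj]
  and matrix_image_subset_iff = inj_image_subset_iff[OF inj]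

lemma indep2_matrix: "indep2 x y \<Longrightarrow> indep2 (T *v x) (T *v y)"
  unfolding indep2_def
proof (intro allI impI)
  fix a b
  assume i: "\<forall>a b. a *s x + b *s y = 0 \<longrightarrow> a = 0 \<and> b = 0" and "a *s (T *v x) + b *s (T *v y) = 0"
  then have "T' *v (a *s (T *v x) + b *s (T *v y)) = 0" by simp
  then have "a *s x + b *s y = 0" by (simp add: matrix_vector_right_distrib vector_scalar_commute)
  with i show "a = 0 \<and> b = 0" by blast
qed

lemma line_image: "l \<in> pg_lines \<Longrightarrow> (*v) T ` l \<in> pg_lines"
  using pg_lineE[of l] indep2_matrix matrix_image_span2 pg_linesI by metis

lemma point_image: "P \<in> pg_points \<Longrightarrow> (*v) T ` P \<in> pg_points"
proof -
  assume "P \<in> pg_points"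
  then obtain v where v: "v \<noteq> 0" "P = vec.span {v}" unfolding pg_points_iff by blast
  have "T *v v \<noteq> 0" using cancel(2)[of v] v(1) by (metis matrix_vector_mult_0_right)
  moreover have "(*v) T ` P = vec.span {T *v v}" unfolding v(2) using matrix_image_span2[of T v v] by simp
  ultimately show ?thesis unfolding pg_points_iff by blast
qed

lemma point_image_iff: "(*v) T ` P \<in> pg_points \<longleftrightarrow> P \<in> pg_points"
  using point_image invertible_matrix.point_image[OF swap] image_cancel by metis

lemma line_image_iff: "(*v) T ` l \<in> pg_lines \<longleftrightarrow> l \<in> pg_lines"
  using line_image invertible_matrix.line_image[OF swap] image_cancel by metis

lemma image_surj: obtains m where "l = (*v) T ` m"
  using invertible_matrix.image_cancel[OF swap] by metis

lemma meets_image: "meets ((*v) T ` l) ((*v) T ` m) \<longleftrightarrow> meets l m"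
proof
  assume "meets l m"
  then obtain P where "P \<in> pg_points" "P \<subseteq> l" "P \<subseteq> m" unfolding meets_def by blast
  then have "(*v) T ` P \<in> pg_points" "(*v) T ` P \<subseteq> (*v) T ` l" "(*v) T ` P \<subseteq> (*v) T ` m"
    by (simp_all add: point_image matrix_image_subset_iff)
  then show "meets ((*v) T ` l) ((*v) T ` m)" unfolding meets_def by blast
next
  assume "meets ((*v) T ` l) ((*v) T ` m)"
  then obtain P where "P \<in> pg_points" "P \<subseteq> (*v) T ` l" "P \<subseteq> (*v) T ` m"
    unfolding meets_def by blast
  moreover obtain P' where "P = (*v) T ` P'" by (rule image_surj)
  ultimately have "P' \<in> pg_points" "P' \<subseteq> l" "P' \<subseteq> m"
    by (simp_all add: point_image_iff matrix_image_subset_iff)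
  then show "meets l m" unfolding meets_def by blast
qed

lemma mem_image_image_iff: "(*v) T ` P \<in> (`) ((*v) T) ` Q \<longleftrightarrow> P \<in> Q"
  by (simp add: image_iff matrix_image_eq_iff)

text \<open>Every set of vectors is an image under \<open>T\<close>, so families of sets can be
  compared on images alone.\<close>

lemma set_eq_if_image_mem_iff:
  assumes "\<And>P. (*v) T ` P \<in> A \<longleftrightarrow> (*v) T ` P \<in> B"
  shows "A = B"
proof (rule set_eqI)
  fix X
  obtain P where "X = (*v) T ` P" by (rule image_surj)
  then show "X \<in> A \<longleftrightarrow> X \<in> B" using assms by simp
qed

lemma quadric_lines_image:
  "quadric_lines ((`) ((*v) T) ` Q) = (`) ((*v) T) ` quadric_lines Q"
proof (rule set_eq_if_image_mem_iff)
  fix l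
  have "(\<forall>P\<in>pg_points. P \<subseteq> (*v) T ` l \<longrightarrow> P \<in> (`) ((*v) T) ` Q) \<longleftrightarrow> (\<forall>P\<in>pg_points. P \<subseteq> l \<longrightarrow> P \<in> Q)"
  proof (intro iffI ballI impI)
    fix P assume *: "\<forall>P\<in>pg_points. P \<subseteq> (*v) T ` l \<longrightarrow> P \<in> (`) ((*v) T) ` Q" and "P \<in> pg_points" "P \<subseteq> l"
    then show "P \<in> Q"
      using *[rule_format, of "(*v) T ` P"]
      by (simp add: point_image_iff matrix_image_subset_iff mem_image_image_iff)
  next
    fix P assume *: "\<forall>P\<in>pg_points. P \<subseteq> l \<longrightarrow> P \<in> Q" and P: "P \<in> pg_points" "P \<subseteq> (*v) T ` l"
    obtain P' where P': "P = (*v) T ` P'" by (rule image_surj)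
    show "P \<in> (`) ((*v) T) ` Q"
      using P *[rule_format, of P']
      by (simp add: P' point_image_iff matrix_image_subset_iff mem_image_image_iff)
  qed
  then show "(*v) T ` l \<in> quadric_lines ((`) ((*v) T) ` Q) \<longleftrightarrow> (*v) T ` l \<in> (`) ((*v) T) ` quadric_lines Q"
    unfolding mem_image_image_iff by (simp add: quadric_lines_def line_image_iff)
qed

lemma image_std_quadric:
  "(`) ((*v) T) ` standard_hyperbolic_quadric = {P \<in> pg_points. \<forall>v\<in>P. std_form (T' *v v) = 0}"
  by (rule set_eq_if_image_mem_iff)
    (simp add: mem_image_image_iff point_image_iff standard_hyperbolic_quadric_def)

end

lemma reguli_image:
  fixes T T' :: "'a::{field,finite} ^ 4 ^ 4"
  assumes "invertible_matrix T T'" "reguli Q R R'"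
  shows "reguli ((`) ((*v) T) ` Q) ((`) ((*v) T) ` R) ((`) ((*v) T) ` R')"
proof -
  interpret invertible_matrix T T' by fact
  have inj: "inj ((`) ((*v) T))" by (rule injI) (simp add: matrix_image_eq_iff)
  show ?thesis
    using assms(2) unfolding reguli_def quadric_lines_image
    by (simp add: image_Un[symmetric] image_Int[OF inj, symmetric] card_image inj_on_subset[OF inj]
        meets_image matrix_image_eq_iff)
qed

lemma hyperbolic_quadricE:
  fixes Q :: "('a::{field,finite} ^ 4) set set"
  assumes "hyperbolic_quadric Q"
  obtains S :: "'a ^ 4 ^ 4" and R R' where
    "Q = {P \<in> pg_points. \<forall>v\<in>P. std_form (S *v v) = 0}" "reguli Q R R'"
proof -
  from assms obtain T :: "'a ^ 4 ^ 4" where T: "invertible T" "Q = (\<lambda>P. (*v) T ` P) ` standard_hyperbolic_quadric"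
    unfolding hyperbolic_quadric_def by blast
  then obtain T' where "invertible_matrix T T'"
    unfolding invertible_def invertible_matrix_def by blast
  then interpret invertible_matrix T T' .
  have "Q = {P \<in> pg_points. \<forall>v\<in>P. std_form (T' *v v) = 0}"
    unfolding T(2) by (rule image_std_quadric)
  moreover have "reguli Q ((`) ((*v) T) ` range (std_ruling 3 4)) ((`) ((*v) T) ` range (std_ruling 4 3))"
    unfolding T(2) by (rule reguli_image[OF \<open>invertible_matrix T T'\<close> reguli_std])
  ultimately show thesis by (rule that)
qed

text \<open>The matrix with columns \<open>c1\<close> to \<open>c4\<close> carries the standard
  quadric to \<open>Q\<close>, and \<open>G\<close> is the standard form in coordinates with respect
  to this basis.\<close>

lemma hyperbolic_quadric_basis:
  fixes c1 c2 c3 c4 :: "'a::field ^ 4"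
  assumes indep: "\<And>y1 y2 y3 y4. y1 *s c1 + y2 *s c2 + y3 *s c3 + y4 *s c4 = 0 \<Longrightarrow> y1 = 0 \<and> y2 = 0 \<and> y3 = 0 \<and> y4 = 0"
  obtains Q G where "hyperbolic_quadric Q" "Q = {P \<in> pg_points. \<forall>v\<in>P. G v = 0}"
    "\<And>y1 y2 y3 y4. G (y1 *s c1 + y2 *s c2 + y3 *s c3 + y4 *s c4) = y1 * y2 + y3 * y4"
    "\<And>v. \<exists>y1 y2 y3 y4. v = y1 *s c1 + y2 *s c2 + y3 *s c3 + y4 *s c4"
proof -
  define T :: "'a ^ 4 ^ 4" where
    "T = (\<chi> i j. if j = 1 then c1 $ i else if j = 2 then c2 $ i else if j = 3 then c3 $ i else c4 $ i)"
  have T: "T *v y = y $ 1 *s c1 + y $ 2 *s c2 + y $ 3 *s c3 + y $ 4 *s c4" for y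
    by (simp add: T_def vec_eq_iff matrix_vector_mult_def sum_4 mult.commute)
  have "y = 0" if "T *v y = 0" for y
    using indep[of "y $ 1" "y $ 2" "y $ 3" "y $ 4"] that unfolding T by (simp add: vec4_eq_iff)
  then have "invertible T"
    using matrix_left_invertible_ker[of T] invertible_left_inverse by blast
  then obtain T' where "invertible_matrix T T'"
    unfolding invertible_def invertible_matrix_def by blast
  then interpret invertible_matrix T T' .
  let ?Q = "(\<lambda>P. (*v) T ` P) ` standard_hyperbolic_quadric"
  have "?Q = {P \<in> pg_points. \<forall>v\<in>P. std_form (T' *v v) = 0}" by (rule image_std_quadric)
  moreover have "hyperbolic_quadric ?Q" unfolding hyperbolic_quadric_def using \<open>invertible T\<close> by blast
  moreover have "std_form (T' *v (y1 *s c1 + y2 *s c2 + y3 *s c3 + y4 *s c4)) = y1 * y2 + y3 * y4" for y1 y2 y3 y4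
  proof -
    define y :: "'a ^ 4" where "y = (\<chi> k. if k = 1 then y1 else if k = 2 then y2 else if k = 3 then y3 else y4)"
    have "y1 *s c1 + y2 *s c2 + y3 *s c3 + y4 *s c4 = T *v y" unfolding T by (simp add: y_def)
    then show ?thesis by (simp add: y_def)
  qed
  moreover have "\<exists>y1 y2 y3 y4. v = y1 *s c1 + y2 *s c2 + y3 *s c3 + y4 *s c4" for v
    using T[of "T' *v v"] by auto
  ultimately show thesis using that[of ?Q "\<lambda>v. std_form (T' *v v)"] by blast
qed

section \<open>Kakeya line sets\<close>

context conic
begin

text \<open>The vectors \<open>d\<close>, \<open>p - r\<close>, \<open>e\<close> represent three
  points of the conic, so they are independent in the plane, and \<open>r\<close> lies off it.
  Rewriting the relation in these four vectors separates the coefficients.\<close>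

lemma path_independent:
  assumes "vec.span {d} \<in> C" "vec.span {e} \<in> C" "vec.span {p - r} \<in> C"
    and "d \<noteq> 0" "e \<noteq> 0" "p \<noteq> r"
    and "vec.span {d} \<noteq> vec.span {e}" "vec.span {d} \<noteq> vec.span {p - r}" "vec.span {e} \<noteq> vec.span {p - r}"
    and r: "r \<notin> \<pi>"
    and zero: "x1 *s d + x2 *s p + x3 *s r + x4 *s e = 0"
  shows "x1 = 0 \<and> x2 = 0 \<and> x3 = 0 \<and> x4 = 0"
proof -
  have pi: "d \<in> \<pi>" "e \<in> \<pi>" "p - r \<in> \<pi>" using assms(1-6) span_in_C_iff by auto
  have eq: "x1 *s d + x2 *s (p - r) + x4 *s e + (x2 + x3) *s r = 0"
    using zero by (simp add: vec.scale_right_diff_distrib vec.scale_left_distrib algebra_simps)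
  then have "(x2 + x3) *s r = - (x1 *s d + x2 *s (p - r) + x4 *s e)"
    by (metis eq_neg_iff_add_eq_0 add.commute)
  then have "(x2 + x3) *s r = - 1 *s (x1 *s d + x2 *s (p - r) + x4 *s e)" by simp
  moreover have "- 1 *s (x1 *s d + x2 *s (p - r) + x4 *s e) \<in> \<pi>"
    using pi by (intro vec.subspace_scale[OF subspace_plane] vec.subspace_add[OF subspace_plane])
  ultimately have "x2 + x3 = 0"
    using scale_mem_subspace_iff[OF subspace_plane, of "x2 + x3" r] r by simp
  moreover have "indep3 d (p - r) e"
    using assms(1-9) by (intro C_indep3) auto
  ultimately show ?thesis
    using eq unfolding indep3_def by (metis add.right_neutral add_cancel_left_left vec.scale_zero_left)
qed

text \<open>
  In the coordinates of \<open>d\<close>, \<open>p\<close>, \<open>r\<close>, \<open>e\<close> the quadrics through the lines \<open>\<langle>d, p\<rangle>\<close>, \<open>\<langle>p, r\<rangle>\<close>, \<open>\<langle>r, e\<rangle>\<close> have the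
  equations \<open>a x\<^sub>1 x\<^sub>3 + b x\<^sub>2 x\<^sub>4 + c x\<^sub>1 x\<^sub>4 = 0\<close>. The plane \<open>\<pi>\<close> is \<open>x\<^sub>2 + x\<^sub>3 = 0\<close>, and agreement with \<open>f\<close> there
  forces \<open>a = - E\<close>, \<open>b = G\<close>, \<open>c = D\<close>; the form then factors as \<open>x\<^sub>1 (D x\<^sub>4 - E x\<^sub>3) + x\<^sub>4 (G x\<^sub>2)\<close>.
\<close>

lemma path_quadric:
  assumes "vec.span {d} \<in> C" "vec.span {e} \<in> C" "vec.span {p - r} \<in> C"
    and "d \<noteq> 0" "e \<noteq> 0" "p \<noteq> r"
    and "vec.span {d} \<noteq> vec.span {e}" "vec.span {d} \<noteq> vec.span {p - r}" "vec.span {e} \<noteq> vec.span {p - r}"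
    and r: "r \<notin> \<pi>"
  obtains Q where "hyperbolic_quadric Q" "{P \<in> Q. P \<subseteq> \<pi>} = C"
    "affine_part \<pi> (vec.span {d, p}) \<subseteq> Q" "affine_part \<pi> (vec.span {p, r}) \<subseteq> Q"
    "affine_part \<pi> (vec.span {r, e}) \<subseteq> Q"
proof -
  define g where "g = p - r"
  note indep = path_independent[OF assms]
  have pi: "d \<in> \<pi>" "e \<in> \<pi>" "g \<in> \<pi>" and f0: "f d = 0" "f e = 0" "f g = 0" and g0: "g \<noteq> 0"
    using assms(1-6) span_in_C_iff by (auto simp: g_def)
  have ind2: "indep2 x y" if "vec.span {x} \<in> C" "vec.span {y} \<in> C" "x \<noteq> 0" "y \<noteq> 0"
    "vec.span {x} \<noteq> vec.span {y}" for x y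
    using that C_points by (intro distinct_points_indep2[of "vec.span {x}" "vec.span {y}"]) (auto intro: vec.span_base)
  define D E G where "D = \<beta> d e" and "E = \<beta> d g" and "G = \<beta> e g"
  have E0: "E \<noteq> 0" unfolding E_def
    using assms g0 by (intro polar_neq_0 pi f0 ind2) (auto simp: g_def)
  have G0: "G \<noteq> 0" unfolding G_def
    using assms g0 by (intro polar_neq_0 pi f0 ind2) (auto simp: g_def)
  \<comment> \<open>Chosen so that the coordinates with respect to \<open>d\<close>,
    \<open>c2\<close>, \<open>c3\<close>, \<open>c4\<close> are the four linear factors
    \<open>x\<^sub>1\<close>, \<open>D x\<^sub>4 - E x\<^sub>3\<close>, \<open>x\<^sub>4\<close>,
    \<open>G x\<^sub>2\<close>. The change of basis is invertible because \<open>E\<close> and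
    \<open>G\<close> are nonzero.\<close>
  define c2 c3 c4 where "c2 = (- 1 / E) *s r" and "c3 = e + (D / E) *s r" and "c4 = (1 / G) *s p"
  have comb: "y1 *s d + y2 *s c2 + y3 *s c3 + y4 *s c4
      = y1 *s d + (y4 / G) *s p + ((D * y3 - y2) / E) *s r + y3 *s e" for y1 y2 y3 y4
    by (simp add: c2_def c3_def c4_def vec_eq_iff) (simp add: field_simps diff_divide_distrib)
  have comb': "x1 *s d + x2 *s p + x3 *s r + x4 *s e
      = x1 *s d + (D * x4 - E * x3) *s c2 + x4 *s c3 + (G * x2) *s c4" for x1 x2 x3 x4
    unfolding comb using E0 G0 by simp
  have ind4: "y1 = 0 \<and> y2 = 0 \<and> y3 = 0 \<and> y4 = 0"
    if "y1 *s d + y2 *s c2 + y3 *s c3 + y4 *s c4 = 0" for y1 y2 y3 y4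
  proof -
    have "y1 = 0 \<and> y4 / G = 0 \<and> (D * y3 - y2) / E = 0 \<and> y3 = 0"
      by (rule indep) (use that in \<open>simp only: comb\<close>)
    then show ?thesis using E0 G0 by auto
  qed
  show thesis
  proof (rule hyperbolic_quadric_basis[OF ind4])
    fix Q F assume Q: "hyperbolic_quadric Q" "Q = {P \<in> pg_points. \<forall>v\<in>P. F v = 0}"
      and F: "\<And>y1 y2 y3 y4. F (y1 *s d + y2 *s c2 + y3 *s c3 + y4 *s c4) = y1 * y2 + y3 * y4"
      and span: "\<And>v. \<exists>y1 y2 y3 y4. v = y1 *s d + y2 *s c2 + y3 *s c3 + y4 *s c4"
    have F': "F (x1 *s d + x2 *s p + x3 *s r + x4 *s e) = x1 * (D * x4 - E * x3) + x4 * (G * x2)" for x1 x2 x3 x4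
      unfolding comb' F ..
    \<comment> \<open>In the plane \<open>x\<^sub>3 = - x\<^sub>2\<close>, and both forms become
      \<open>E x\<^sub>1 x\<^sub>2 + D x\<^sub>1 x\<^sub>4 + G x\<^sub>2 x\<^sub>4\<close>.\<close>
    have Ff: "F v = f v" if "v \<in> \<pi>" for v
    proof -
      obtain x1 x2 x3 x4 where v: "v = x1 *s d + x2 *s p + x3 *s r + x4 *s e"
        using span[of v] unfolding comb by blast
      have v': "v = x1 *s d + x2 *s g + x4 *s e + (x2 + x3) *s r"
        unfolding v g_def by (simp add: vec.scale_right_diff_distrib vec.scale_left_distrib algebra_simps)
      then have "(x2 + x3) *s r = v - (x1 *s d + x2 *s g + x4 *s e)" by simp
      moreover have "v - (x1 *s d + x2 *s g + x4 *s e) \<in> \<pi>"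
        using pi that
        by (intro vec.subspace_diff[OF subspace_plane] vec.subspace_scale[OF subspace_plane]
            vec.subspace_add[OF subspace_plane])
      ultimately have "x2 + x3 = 0"
        using scale_mem_subspace_iff[OF subspace_plane, of "x2 + x3" r] r by simp
      then have x3: "x3 = - x2" and v: "v = x1 *s d + x2 *s g + x4 *s e"
        using v' by (simp_all add: eq_neg_iff_add_eq_0 add.commute)
      have "f v = x1 * x2 * E + x1 * x4 * D + x2 * x4 * G"
        unfolding v using f0 by (simp add: quad_form_add quad_form_scale polar_form_add polar_form_scale polar_form_add_right
            polar_form_scale_right D_def E_def G_def polar_form_commute[of M g e] algebra_simps)
      moreover have "F v = x1 * (D * x4 - E * x3) + x4 * (G * x2)"
        using F'[of x1 x2 x3 x4] \<open>v = x1 *s d + x2 *s p + x3 *s r + x4 *s e\<close> by simp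
      ultimately show ?thesis unfolding x3 by (simp add: algebra_simps)
    qed
    have "(\<forall>v\<in>P. F v = 0) \<longleftrightarrow> (\<forall>v\<in>P. f v = 0)" if "P \<subseteq> \<pi>" for P
      using Ff that by (intro ball_cong) auto
    then have "{P \<in> Q. P \<subseteq> \<pi>} = C" unfolding Q(2) C_eq by auto
    moreover have part: "affine_part \<pi> l \<subseteq> Q" if "\<And>v. v \<in> l \<Longrightarrow> F v = 0" for l
      unfolding affine_part_def ag_points_def Q(2) using that by auto
    have "affine_part \<pi> (vec.span {d, p}) \<subseteq> Q"
    proof (rule part)
      fix v assume "v \<in> vec.span {d, p}"
      then obtain a b where "v = a *s d + b *s p" unfolding in_span2 by blast
      then show "F v = 0" using F'[of a b 0 0] by simp
    qed
    moreover have "affine_part \<pi> (vec.span {p, r}) \<subseteq> Q"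
    proof (rule part)
      fix v assume "v \<in> vec.span {p, r}"
      then obtain a b where "v = a *s p + b *s r" unfolding in_span2 by blast
      then show "F v = 0" using F'[of 0 a b 0] by simp
    qed
    moreover have "affine_part \<pi> (vec.span {r, e}) \<subseteq> Q"
    proof (rule part)
      fix v assume "v \<in> vec.span {r, e}"
      then obtain a b where "v = a *s r + b *s e" unfolding in_span2 by blast
      then show "F v = 0" using F'[of 0 0 a b] by simp
    qed
    ultimately show thesis using that Q(1) by blast
  qed
qed

end

section \<open>Incidence of the lines of a Kakeya line set\<close>

locale kakeya = conic +
  fixes L :: "('a ^ 4) set set"
  assumes kakeya: "kakeya_line_set \<pi> C L"
begin

lemma L_ag_lines: "l \<in> L \<Longrightarrow> l \<in> ag_lines \<pi>"
  and L_infinity: "l \<in> L \<Longrightarrow> l \<inter> \<pi> \<in> C"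
  using kakeya by (auto simp: kakeya_line_set_def linear_rep_lines_def)

lemma L_pg_lines: "l \<in> L \<Longrightarrow> l \<in> pg_lines"
  using L_ag_lines by (auto simp: ag_lines_def)

lemma L_subspace: "l \<in> L \<Longrightarrow> vec.subspace l"
  using L_pg_lines by (auto simp: pg_lines_def)

lemma line_eq: "l \<in> L \<Longrightarrow> m \<in> L \<Longrightarrow> P \<in> C \<Longrightarrow> P \<subseteq> l \<Longrightarrow> P \<subseteq> m \<Longrightarrow> l = m"
  using kakeya unfolding kakeya_line_set_def by blast

lemma inj_infinity: "inj_on (\<lambda>l. l \<inter> \<pi>) L"
proof (rule inj_onI)
  fix l m assume "l \<in> L" "m \<in> L" "l \<inter> \<pi> = m \<inter> \<pi>"
  then show "l = m" using line_eq[of l m "l \<inter> \<pi>"] L_infinity by blast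
qed

lemma point_at_infinity:
  assumes "l \<in> L" "P \<in> pg_points" "P \<subseteq> l" "P \<subseteq> \<pi>"
  shows "P = l \<inter> \<pi>"
proof -
  obtain v where v: "v \<noteq> 0" "P = vec.span {v}" using assms(2) unfolding pg_points_iff by blast
  then have "v \<in> l \<inter> \<pi>" using assms(3,4) vec.span_base[of v "{v}"] by auto
  then show ?thesis using pg_point_eq_span[of "l \<inter> \<pi>" v] L_infinity[OF assms(1)] C_points v by auto
qed

text \<open>Sending a line to its point at infinity is a bijection from \<open>L\<close> to the
  conic.\<close>

lemma card_L: "card L = CARD('a) + 1"
proof -
  have "(\<lambda>l. l \<inter> \<pi>) ` L = C"
  proof (intro equalityI subsetI)
    fix P assume P: "P \<in> C"
    then obtain l where "l \<in> L" "P \<subseteq> l" using kakeya unfolding kakeya_line_set_def by blast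
    moreover have "P \<subseteq> \<pi>" "P \<in> pg_points" using P by (auto simp: C_eq)
    ultimately show "P \<in> (\<lambda>l. l \<inter> \<pi>) ` L" using point_at_infinity by blast
  qed (use L_infinity in auto)
  then show ?thesis using card_image[OF inj_infinity] card_C by simp
qed

lemma lineE:
  assumes "l \<in> L"
  obtains d where "d \<noteq> 0" "d \<in> \<pi>" "d \<in> l" "l \<inter> \<pi> = vec.span {d}" "vec.span {d} \<in> C"
    "\<And>p. p \<in> l \<Longrightarrow> p \<notin> \<pi> \<Longrightarrow> indep2 d p \<and> l = vec.span {d, p}"
proof -
  obtain d where d: "d \<noteq> 0" "l \<inter> \<pi> = vec.span {d}"
    using L_infinity[OF assms] unfolding C_iff by blast
  then have dl: "d \<in> l" "d \<in> \<pi>" using vec.span_base[of d "{d}"] by auto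
  then show thesis
    using that[of d] d L_infinity[OF assms] ag_line_eq_span[OF plane L_ag_lines[OF assms] dl d(1)] by auto
qed

lemmas affine_partD = affine_partE[OF subspace_plane]

text \<open>Coordinates for a path, in the shape that \<open>path_independent\<close> and
  \<open>path_quadric\<close> expect: \<open>p\<close> and \<open>r\<close> represent the two affine
  vertices, and \<open>d\<close>, \<open>p - r\<close>, \<open>e\<close> the points at infinity of
  the three lines.\<close>

lemma pathE:
  assumes L: "u \<in> L" "t \<in> L" "w \<in> L" "u \<noteq> t" "t \<noteq> w" "u \<noteq> w"
    and X: "X \<in> affine_part \<pi> u" "X \<in> affine_part \<pi> t"
    and Y: "Y \<in> affine_part \<pi> t" "Y \<in> affine_part \<pi> w" and XY: "X \<noteq> Y"
  obtains d p r e where "u = vec.span {d, p}" "t = vec.span {p, r}" "w = vec.span {r, e}"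
    "vec.span {d} \<in> C" "vec.span {e} \<in> C" "vec.span {p - r} \<in> C"
    "d \<noteq> 0" "e \<noteq> 0" "p \<noteq> r"
    "vec.span {d} \<noteq> vec.span {e}" "vec.span {d} \<noteq> vec.span {p - r}" "vec.span {e} \<noteq> vec.span {p - r}"
    "r \<notin> \<pi>"
proof -
  obtain p where p: "p \<noteq> 0" "X = vec.span {p}" "p \<in> u" "p \<notin> \<pi>" using affine_partD[OF X(1)] .
  have pt: "p \<in> t" using X(2) p(2) vec.span_base[of p "{p}"] by (auto simp: affine_part_def)
  obtain y where y: "y \<noteq> 0" "Y = vec.span {y}" "y \<in> t" "y \<notin> \<pi>" using affine_partD[OF Y(1)] .
  have yw: "y \<in> w" using Y(2) y(2) vec.span_base[of y "{y}"] by (auto simp: affine_part_def)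
  \<comment> \<open>Scaling the representative of \<open>Y\<close> by \<open>k\<close> moves the
    difference from \<open>p\<close> into the plane, where it represents the point at infinity of
    \<open>t\<close>.\<close>
  obtain k where k: "p - k *s y \<in> \<pi>" using plane_split[OF plane y(4)] .
  define r where "r = k *s y"
  have k0: "k \<noteq> 0" using k p(4) by auto
  have Yr: "Y = vec.span {r}" using span1_eq_iff[OF y(1), of r] k0 y(2) by (auto simp: r_def)
  have r: "r \<in> t" "r \<in> w" "r \<notin> \<pi>"
    using y yw k0 by (simp_all add: r_def scale_mem_subspace_iff[OF L_subspace] L scale_mem_subspace_iff[OF subspace_plane])
  have pr: "p \<noteq> r" using XY p(2) Yr by auto
  have r0: "r \<noteq> 0" using r vec.subspace_0[OF subspace_plane] by auto
  have "indep2 p r"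
    using distinct_points_indep2[of X Y p r] X Y XY p Yr r0 vec.span_base
    by (auto simp: affine_part_def ag_points_def)
  then have t: "t = vec.span {p, r}" using pg_line_eq_span[OF L_pg_lines[OF L(2)] pt r(1)] by blast
  have g: "p - r \<in> t \<inter> \<pi>"
    using k vec.subspace_diff[OF L_subspace[OF L(2)] pt r(1)] by (simp add: r_def)
  then have tpi: "t \<inter> \<pi> = vec.span {p - r}"
    using pg_point_eq_span[of "t \<inter> \<pi>" "p - r"] L_infinity[OF L(2)] C_points pr by auto
  obtain d where d: "d \<noteq> 0" "u \<inter> \<pi> = vec.span {d}" "u = vec.span {d, p}" "vec.span {d} \<in> C"
    using lineE[OF L(1)] p by metis
  obtain e where e: "e \<noteq> 0" "w \<inter> \<pi> = vec.span {e}" "w = vec.span {e, r}" "vec.span {e} \<in> C"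
    using lineE[OF L(3)] r by metis
  show thesis
  proof (rule that[OF d(3) t _ d(4) e(4) _ d(1) e(1) pr _ _ _ r(3)])
    show "w = vec.span {r, e}" using e(3) by (simp add: insert_commute)
    show "vec.span {p - r} \<in> C" using L_infinity[OF L(2)] tpi by simp
    show "vec.span {d} \<noteq> vec.span {e}" "vec.span {d} \<noteq> vec.span {p - r}" "vec.span {e} \<noteq> vec.span {p - r}"
      unfolding d(2)[symmetric] e(2)[symmetric] tpi[symmetric]
      using inj_onD[OF inj_infinity] L by metis+
  qed
qed

text \<open>For \<open>triangle\<close>, a proper triangle would be a path whose end lines meet, but
  by \<open>path_independent\<close> these lines are skew.\<close>

sublocale line_family L "affine_part \<pi>" "CARD('a)"
proof unfold_locales
  show "finite L" by simp
  show "0 < CARD('a)" by simp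
next
  fix l assume l: "l \<in> L"
  obtain p where p: "p \<in> l" "p \<notin> \<pi>" using L_ag_lines[OF l] by (auto simp: ag_lines_def)
  obtain d where "d \<noteq> 0" "d \<in> \<pi>" "l = vec.span {d, p}" using lineE[OF l] p by metis
  then show "card (affine_part \<pi> l) = CARD('a)" using card_affine_part[OF plane, of d p] p by simp
next
  fix l m X Y assume lm: "l \<in> L" "m \<in> L" "l \<noteq> m"
    and X: "X \<in> affine_part \<pi> l" "X \<in> affine_part \<pi> m" and Y: "Y \<in> affine_part \<pi> l" "Y \<in> affine_part \<pi> m"
  show "X = Y"
  proof (rule ccontr)
    assume "X \<noteq> Y"
    obtain x where x: "x \<noteq> 0" "X = vec.span {x}" "x \<in> l" using affine_partD[OF X(1)] .
    obtain y where y: "y \<noteq> 0" "Y = vec.span {y}" "y \<in> l" using affine_partD[OF Y(1)] .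
    have m: "x \<in> m" "y \<in> m"
      using X(2) Y(2) x(2) y(2) vec.span_base[of x "{x}"] vec.span_base[of y "{y}"] by (auto simp: affine_part_def)
    have "indep2 x y"
      using distinct_points_indep2[of X Y x y] \<open>X \<noteq> Y\<close> x y vec.span_base by (auto simp: pg_points_iff)
    then show False
      using pg_line_eq_span[OF L_pg_lines] lm x y m by metis
  qed
next
  fix l m n X Y Z
  assume lmn: "l \<in> L" "m \<in> L" "n \<in> L" "l \<noteq> m" "m \<noteq> n" "l \<noteq> n"
    and XY: "X \<in> affine_part \<pi> l" "X \<in> affine_part \<pi> m" "Y \<in> affine_part \<pi> m" "Y \<in> affine_part \<pi> n"
    and Z: "Z \<in> affine_part \<pi> l" "Z \<in> affine_part \<pi> n"
  show "X = Y"
  proof (rule ccontr)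
    assume "X \<noteq> Y"
    obtain d p r e where path: "l = vec.span {d, p}" "m = vec.span {p, r}" "n = vec.span {r, e}"
      "vec.span {d} \<in> C" "vec.span {e} \<in> C" "vec.span {p - r} \<in> C"
      "d \<noteq> 0" "e \<noteq> 0" "p \<noteq> r"
      "vec.span {d} \<noteq> vec.span {e}" "vec.span {d} \<noteq> vec.span {p - r}" "vec.span {e} \<noteq> vec.span {p - r}"
      "r \<notin> \<pi>"
      using pathE[OF lmn XY \<open>X \<noteq> Y\<close>] .
    obtain z where z: "z \<noteq> 0" "Z = vec.span {z}" "z \<in> l" using affine_partD[OF Z(1)] .
    have "z \<in> n" using Z(2) z(2) vec.span_base[of z "{z}"] by (auto simp: affine_part_def)
    then obtain a b a' b' where ab: "z = a *s d + b *s p" "z = a' *s r + b' *s e"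
      using z(3) unfolding path(1,3) in_span2 by blast
    have "a *s d + b *s p + (- a') *s r + (- b') *s e = 0"
      using ab by (simp add: algebra_simps)
    then have "a = 0 \<and> b = 0" using path_independent[OF path(4-13)] by blast
    then show False using ab(1) z(1) by simp
  qed
qed

text \<open>The line also meets the quadric in its point at infinity, and a quadratic form with
  three zeros on a projective line vanishes on the whole line.\<close>

lemma secant:
  assumes Q: "hyperbolic_quadric Q" "{P \<in> Q. P \<subseteq> \<pi>} = C"
    and l: "l \<in> L" and X: "X \<in> affine_part \<pi> l \<inter> Q" and Y: "Y \<in> affine_part \<pi> l \<inter> Q" and XY: "X \<noteq> Y"
  shows "affine_part \<pi> l \<subseteq> Q"
proof -
  obtain S :: "'a ^ 4 ^ 4" and R R'
    where S: "Q = {P \<in> pg_points. \<forall>v\<in>P. std_form (S *v v) = 0}" and "reguli Q R R'"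
    using hyperbolic_quadricE[OF Q(1)] .
  define F where "F v = std_form (S *v v)" for v
  \<comment> \<open>The polar form of \<open>F\<close>; on the line through \<open>x\<close> and
    \<open>y\<close>, only the term with \<open>H x y\<close> can be nonzero.\<close>
  define H where "H v w = (S *v v) $ 1 * (S *v w) $ 2 + (S *v w) $ 1 * (S *v v) $ 2
    + (S *v v) $ 3 * (S *v w) $ 4 + (S *v w) $ 3 * (S *v v) $ 4" for v w
  have F: "F (a *s v + b *s w) = a\<^sup>2 * F v + b\<^sup>2 * F w + a * b * H v w" for a b v w
    by (simp add: F_def H_def matrix_vector_right_distrib vector_scalar_commute power2_eq_square algebra_simps)
  obtain x where x: "x \<noteq> 0" "X = vec.span {x}" "x \<in> l" "x \<notin> \<pi>" using affine_partD X by blast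
  obtain y where y: "y \<noteq> 0" "Y = vec.span {y}" "y \<in> l" "y \<notin> \<pi>" using affine_partD Y by blast
  obtain d where d: "d \<noteq> 0" "d \<in> \<pi>" "d \<in> l" "vec.span {d} \<in> C" using lineE[OF l] by metis
  have "vec.span {d} \<in> Q" using d(4) Q(2) by auto
  moreover have "vec.span {x} \<in> Q" "vec.span {y} \<in> Q" using X Y x(2) y(2) by auto
  moreover have "F v = 0" if "vec.span {v} \<in> Q" for v
    using that vec.span_base[of v "{v}"] unfolding S F_def by blast
  ultimately have F0: "F x = 0" "F y = 0" "F d = 0" by blast+
  have "indep2 x y"
    using distinct_points_indep2[of X Y x y] XY x y vec.span_base by (auto simp: pg_points_iff)
  then have lxy: "l = vec.span {x, y}" using pg_line_eq_span[OF L_pg_lines[OF l] x(3) y(3)] by blast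
  then obtain a b where ab: "d = a *s x + b *s y" using d(3) in_span2 by blast
  \<comment> \<open>Both coefficients are nonzero since \<open>d\<close> is at infinity and
    \<open>x\<close>, \<open>y\<close> are affine; hence \<open>F d = a * b * H x y = 0\<close>
    forces \<open>H x y = 0\<close>.\<close>
  have "a \<noteq> 0"
    using ab d(1,2) y(4) scale_mem_subspace_iff[OF subspace_plane, of b y] by (cases "b = 0") auto
  moreover have "b \<noteq> 0"
    using ab d(1,2) x(4) scale_mem_subspace_iff[OF subspace_plane, of a x] by (cases "a = 0") auto
  ultimately have "H x y = 0" using F[of a x b y] F0 ab(1)[symmetric] by simp
  then have "F v = 0" if "v \<in> l" for v
  proof -
    from that obtain a' b' where "v = a' *s x + b' *s y" unfolding lxy in_span2 by blast
    then show ?thesis using F[of a' x b' y] F0 \<open>H x y = 0\<close> by simp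
  qed
  then show ?thesis unfolding S F_def affine_part_def ag_points_def by blast
qed

lemma kakeya_set_eq: "kakeya_set \<pi> L = (\<Union>l\<in>L. affine_part \<pi> l)"
  by (auto simp: kakeya_set_def affine_part_def)

text \<open>\<open>covered\<close> is applied to the hyperbolic quadrics that cut the plane at
  infinity exactly in the conic. It places the affine points of each line on one of them, and the
  point at infinity lies there because it belongs to the conic.\<close>

lemma exists_quadric:
  assumes odd: "odd CARD('a)"
    and small: "4 * card (kakeya_set \<pi> L) < 3 * ((CARD('a))\<^sup>2 - 1) + 4 * CARD('a)"
  obtains Q where "hyperbolic_quadric Q" "{P \<in> Q. P \<subseteq> \<pi>} = C" "L \<subseteq> quadric_lines Q"
proof -
  have "\<exists>Q\<in>{Q. hyperbolic_quadric Q \<and> {P \<in> Q. P \<subseteq> \<pi>} = C}. \<forall>l\<in>L. affine_part \<pi> l \<subseteq> Q"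
  proof (rule covered[OF odd card_L small[unfolded kakeya_set_eq]])
    fix u t w X Y
    assume path: "u \<in> L" "t \<in> L" "w \<in> L" "u \<noteq> t" "t \<noteq> w" "u \<noteq> w"
      "X \<in> affine_part \<pi> u" "X \<in> affine_part \<pi> t" "Y \<in> affine_part \<pi> t" "Y \<in> affine_part \<pi> w" "X \<noteq> Y"
    obtain d p r e where *: "u = vec.span {d, p}" "t = vec.span {p, r}" "w = vec.span {r, e}"
      "vec.span {d} \<in> C" "vec.span {e} \<in> C" "vec.span {p - r} \<in> C"
      "d \<noteq> 0" "e \<noteq> 0" "p \<noteq> r"
      "vec.span {d} \<noteq> vec.span {e}" "vec.span {d} \<noteq> vec.span {p - r}" "vec.span {e} \<noteq> vec.span {p - r}"
      "r \<notin> \<pi>"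
      using pathE[OF path] .
    obtain Q where "hyperbolic_quadric Q" "{P \<in> Q. P \<subseteq> \<pi>} = C"
      "affine_part \<pi> u \<subseteq> Q" "affine_part \<pi> t \<subseteq> Q" "affine_part \<pi> w \<subseteq> Q"
      using path_quadric[OF *(4-13)] unfolding *(1-3) .
    then show "\<exists>Z\<in>{Q. hyperbolic_quadric Q \<and> {P \<in> Q. P \<subseteq> \<pi>} = C}.
        affine_part \<pi> u \<subseteq> Z \<and> affine_part \<pi> t \<subseteq> Z \<and> affine_part \<pi> w \<subseteq> Z"
      by blast
  next
    fix Z l X Y
    assume "Z \<in> {Q. hyperbolic_quadric Q \<and> {P \<in> Q. P \<subseteq> \<pi>} = C}" "l \<in> L" "\<not> affine_part \<pi> l \<subseteq> Z"
      "X \<in> affine_part \<pi> l \<inter> Z" "Y \<in> affine_part \<pi> l \<inter> Z"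
    then show "X = Y" using secant[of Z l X Y] by blast
  qed blast
  then obtain Q where Q: "hyperbolic_quadric Q" "{P \<in> Q. P \<subseteq> \<pi>} = C"
    and sub: "\<And>l. l \<in> L \<Longrightarrow> affine_part \<pi> l \<subseteq> Q" by blast
  have "L \<subseteq> quadric_lines Q"
  proof
    fix l assume l: "l \<in> L"
    have "P \<in> Q" if "P \<in> pg_points" "P \<subseteq> l" for P
    proof (cases "P \<subseteq> \<pi>")
      case True
      then show ?thesis using point_at_infinity[OF l that] L_infinity[OF l] Q(2) by auto
    next
      case False
      then show ?thesis using that sub[OF l] by (auto simp: affine_part_def ag_points_def)
    qed
    then show "l \<in> quadric_lines Q" using L_pg_lines[OF l] by (simp add: quadric_lines_def)
  qed
  with Q show thesis by (rule that)
qed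

text \<open>Lines of one regulus are disjoint, so at most one of them passes through a given point
  of the conic. Sorting the points by the regulus that contains their line of \<open>L\<close>
  therefore recovers exactly \<open>L\<close>.\<close>

lemma lines_through_reguli:
  assumes "reguli Q R R'" "L \<subseteq> quadric_lines Q"
  defines "A \<equiv> {P \<in> C. \<exists>l\<in>L \<inter> R. P \<subseteq> l}"
  shows "lines_through R A \<union> lines_through R' (C - A) = L"
proof -
  have cover: "L \<subseteq> R \<union> R'"
    and skew: "\<And>l m. l \<in> R \<Longrightarrow> m \<in> R \<Longrightarrow> l \<noteq> m \<Longrightarrow> \<not> meets l m"
      "\<And>l m. l \<in> R' \<Longrightarrow> m \<in> R' \<Longrightarrow> l \<noteq> m \<Longrightarrow> \<not> meets l m"
    using assms(1,2) by (simp_all add: reguli_def)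
  have meets: "meets l m" if "P \<in> C" "P \<subseteq> l" "P \<subseteq> m" for P l m
    using that C_points unfolding meets_def by blast
  show ?thesis
  proof (intro equalityI subsetI)
    fix l assume l: "l \<in> L"
    have P: "l \<inter> \<pi> \<in> C" "l \<inter> \<pi> \<subseteq> l" using L_infinity[OF l] by auto
    show "l \<in> lines_through R A \<union> lines_through R' (C - A)"
    proof (cases "l \<in> R")
      case True
      then have "l \<inter> \<pi> \<in> A" using P l unfolding A_def by blast
      then show ?thesis using True P unfolding lines_through_def by blast
    next
      case False
      then have "l \<in> R'" using cover l by blast
      moreover have "l \<inter> \<pi> \<notin> A" using False P line_eq[OF l] unfolding A_def by blast
      ultimately show ?thesis using P unfolding lines_through_def by blast
    qed
  next
    fix l assume "l \<in> lines_through R A \<union> lines_through R' (C - A)"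
    then show "l \<in> L"
    proof
      assume "l \<in> lines_through R A"
      then obtain P m where "l \<in> R" "P \<in> C" "P \<subseteq> l" "m \<in> L" "m \<in> R" "P \<subseteq> m"
        unfolding lines_through_def A_def by blast
      then show ?thesis using skew(1)[of l m] meets[of P l m] by blast
    next
      assume "l \<in> lines_through R' (C - A)"
      then obtain P where P: "l \<in> R'" "P \<in> C" "P \<subseteq> l" "P \<notin> A" unfolding lines_through_def by blast
      obtain m where m: "m \<in> L" "P \<subseteq> m" using P(2) kakeya unfolding kakeya_line_set_def by blast
      \<comment> \<open>If \<open>m\<close> were in \<open>R\<close>, it would witness that
        \<open>P\<close> belongs to \<open>A\<close>.\<close>
      then have "m \<in> R'" using P cover unfolding A_def by blast
      then show ?thesis using skew(2)[of l m] meets[of P l m] P m by blast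
    qed
  qed
qed

end

theorem theorem3p4:
  fixes \<pi> :: "('a::{field,finite} ^ 4) set"
    and C L :: "('a ^ 4) set set"
  assumes "odd CARD('a)"
    and "\<pi> \<in> pg_planes"
    and "nonsingular_conic \<pi> C"
    and "kakeya_line_set \<pi> C L"
    and "real (card (kakeya_set \<pi> L)) < 3 / 4 * ((real CARD('a))\<^sup>2 - 1) + real CARD('a)"
  shows "\<exists>Q R R' A B.
           hyperbolic_quadric Q \<and> {P \<in> Q. P \<subseteq> \<pi>} = C \<and> reguli Q R R' \<and>
           A \<union> B = C \<and> A \<inter> B = {} \<and>
           kakeya_line_set \<pi> C (lines_through R A \<union> lines_through R' B) \<and>
           kakeya_set \<pi> L = kakeya_set \<pi> (lines_through R A \<union> lines_through R' B)"
proof -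
  obtain M where M: "\<forall>v\<in>\<pi>. v \<noteq> 0 \<and> quad_form M v = 0 \<longrightarrow> (\<exists>w\<in>\<pi>. polar_form M v w \<noteq> 0)"
    "C = {P \<in> pg_points. P \<subseteq> \<pi> \<and> (\<forall>v\<in>P. quad_form M v = 0)}"
    using assms(3) unfolding nonsingular_conic_def by blast
  interpret kakeya \<pi> M C L
    using assms(2,4) M two_neq_0_of_odd_card[OF assms(1)] by unfold_locales auto
  \<comment> \<open>Keeps the subtraction of 1 from being truncated when the bound, multiplied by 4,
    passes to natural numbers.\<close>
  have "1 \<le> CARD('a)\<^sup>2" by simp
  moreover have "4 * real (card (kakeya_set \<pi> L)) < 3 * ((real CARD('a))\<^sup>2 - 1) + 4 * real CARD('a)"
    using assms(5) by (simp add: field_simps)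
  ultimately have "real (4 * card (kakeya_set \<pi> L)) < real (3 * ((CARD('a))\<^sup>2 - 1) + 4 * CARD('a))"
    by (simp add: of_nat_diff)
  then have "4 * card (kakeya_set \<pi> L) < 3 * ((CARD('a))\<^sup>2 - 1) + 4 * CARD('a)"
    unfolding of_nat_less_iff .
  then obtain Q where Q: "hyperbolic_quadric Q" "{P \<in> Q. P \<subseteq> \<pi>} = C" "L \<subseteq> quadric_lines Q"
    using exists_quadric[OF assms(1)] by blast
  obtain S :: "'a ^ 4 ^ 4" and R R'
    where "Q = {P \<in> pg_points. \<forall>v\<in>P. std_form (S *v v) = 0}" and R: "reguli Q R R'"
    using hyperbolic_quadricE[OF Q(1)] .
  define A where "A = {P \<in> C. \<exists>l\<in>L \<inter> R. P \<subseteq> l}"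
  \<comment> \<open>The new line set is \<open>L\<close> itself, so it is a Kakeya line set and
    covers the same points.\<close>
  have "lines_through R A \<union> lines_through R' (C - A) = L"
    unfolding A_def by (rule lines_through_reguli[OF R Q(3)])
  moreover have "A \<union> (C - A) = C" "A \<inter> (C - A) = {}" by (auto simp: A_def)
  ultimately show ?thesis
    using Q(1,2) R assms(4)
    by (intro exI[of _ Q] exI[of _ R] exI[of _ R'] exI[of _ A] exI[of _ "C - A"]) simp
qed

end
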